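(* (In $\mathsf{ZF}$, without the axiom of choice.) For all infinite cardinals $\mathfrak{a}$, \[ 2^{\mathrm{seq}^{1\text{-}1}(\mathfrak{a})}=2^{\mathrm{fin}(\mathrm{fin}(\mathfrak{a}))}=2^{\mathrm{fin}(\mathrm{fin}(\mathrm{fin}(\mathfrak{a})))}=\dots=2^{\mathrm{seq}(\mathfrak{a})}; \] that is, $2^{\mathrm{seq}^{1\text{-}1}(\mathfrak{a})}=2^{\mathrm{seq}(\mathfrak{a})}$, and for every natural number $m\geqslant 2$, $2^{\mathrm{fin}^{(m)}(\mathfrak{a})}=2^{\mathrm{seq}(\mathfrak{a})}$, where $\mathrm{fin}^{(m)}$ denotes the $m$-fold iterate of $\mathrm{fin}$.
   Context: The setting is $\mathsf{ZF}$; the axiom of choice is not assumed. The cardinality $|x|$ of a set $x$ is defined so that $|x|=|y|$ if and only if there is a bijection between $x$ and $y$ (if $x$ is well-orderable, $|x|$ is the least ordinal equinumerous to $x$; otherwise $|x|$ is the set of all sets of least rank equinumerous to $x$). A cardinal $\mathfrak{a}=|x|$ is infinite if $x$ is infinite, i.e. not equinumerous to any natural number. For a set $x$ with $\mathfrak{a}=|x|$: $\mathrm{fin}(x)$ is the set of all finite subsets of $x$ and $\mathrm{fin}(\mathfrak{a})=|\mathrm{fin}(x)|$; $\mathrm{seq}(x)=\bigcup_{n\in\omega}x^n$ is the set of all finite sequences of elements of $x$ and $\mathrm{seq}(\mathfrak{a})=|\mathrm{seq}(x)|$; $\mathrm{seq}^{1\text{-}1}(x)$ is the set of all injective finite sequences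 of elements of $x$ (injections from some $n=\{0,\dots,n-1\}\in\omega$ into $x$) and $\mathrm{seq}^{1\text{-}1}(\mathfrak{a})=|\mathrm{seq}^{1\text{-}1}(x)|$; $2^{\mathfrak{a}}$ is the cardinality of the power set of $x$. *)

theory Defs
  imports Main
begin

text \<open>
  HOL has a choice operator, and in HOL the theorem about HOL sets is a triviality of cardinal
  arithmetic. Provability in ZF is therefore rendered semantically: the theorem is about an arbitrary
  structure \<open>(V, \<epsilon>)\<close> that satisfies the first-order axioms of ZF, and all set-theoretic notions
  are interpreted inside it. It is essential that Separation and Replacement are
  restricted to first-order formulas; with arbitrary HOL predicates the model would inherit choice.
\<close>

section \<open>Models of ZF\<close>

text \<open>Formulas of the language of set theory, with de Bruijn indices as variables.\<close>

datatype fm = Mem nat nat | Eq nat nat | Neg fm | Conj fm fm | All fm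

primrec sat :: "('v \<Rightarrow> 'v \<Rightarrow> bool) \<Rightarrow> (nat \<Rightarrow> 'v) \<Rightarrow> fm \<Rightarrow> bool" where
  "sat E v (Mem i j) \<longleftrightarrow> E (v i) (v j)"
| "sat E v (Eq i j) \<longleftrightarrow> v i = v j"
| "sat E v (Neg p) \<longleftrightarrow> \<not> sat E v p"
| "sat E v (Conj p q) \<longleftrightarrow> sat E v p \<and> sat E v q"
| "sat E v (All p) \<longleftrightarrow> (\<forall>x. sat E (case_nat x v) p)"

text \<open>In the two schemes the valuation \<open>v\<close> supplies the parameters of the formula.\<close>

locale ZF_model =
  fixes E :: "'v \<Rightarrow> 'v \<Rightarrow> bool" (infix "\<epsilon>" 50)
  assumes extensionality: "(\<forall>z. z \<epsilon> x \<longleftrightarrow> z \<epsilon> y) \<Longrightarrow> x = y"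
    and foundation: "\<exists>y. y \<epsilon> x \<Longrightarrow> \<exists>y. y \<epsilon> x \<and> \<not> (\<exists>z. z \<epsilon> x \<and> z \<epsilon> y)"
    and pairing: "\<exists>z. \<forall>w. w \<epsilon> z \<longleftrightarrow> w = x \<or> w = y"
    and union: "\<exists>u. \<forall>z. z \<epsilon> u \<longleftrightarrow> (\<exists>y. y \<epsilon> x \<and> z \<epsilon> y)"
    and power_set: "\<exists>p. \<forall>z. z \<epsilon> p \<longleftrightarrow> (\<forall>w. w \<epsilon> z \<longrightarrow> w \<epsilon> x)"
    and infinity: "\<exists>i. (\<exists>e. e \<epsilon> i \<and> (\<forall>z. \<not> z \<epsilon> e)) \<and>
      (\<forall>x. x \<epsilon> i \<longrightarrow> (\<exists>s. s \<epsilon> i \<and> (\<forall>z. z \<epsilon> s \<longleftrightarrow> z \<epsilon> x \<or> z = x)))"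
    and separation: "\<exists>y. \<forall>z. z \<epsilon> y \<longleftrightarrow> z \<epsilon> x \<and> sat E (case_nat z v) \<phi>"
    and replacement:
      "(\<forall>x. x \<epsilon> d \<longrightarrow> (\<forall>y z. sat E (case_nat x (case_nat y v)) \<phi> \<longrightarrow>
                             sat E (case_nat x (case_nat z v)) \<phi> \<longrightarrow> y = z)) \<Longrightarrow>
       \<exists>r. \<forall>y. y \<epsilon> r \<longleftrightarrow> (\<exists>x. x \<epsilon> d \<and> sat E (case_nat x (case_nat y v)) \<phi>)"

section \<open>Set-theoretic notions inside a model\<close>

context
  fixes E :: "'v \<Rightarrow> 'v \<Rightarrow> bool" (infix "\<epsilon>" 50)
begin

text \<open>
  The set of the model whose elements are exactly the \<open>y\<close> with \<open>P y\<close>. In a model of ZF there is at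
  most one by extensionality. Below, it is only used for classes that ZF proves to be sets, with
  \<open>P\<close> first-order definable over the model.
\<close>

definition setof :: "('v \<Rightarrow> bool) \<Rightarrow> 'v" where
  "setof P = (THE z. \<forall>y. y \<epsilon> z \<longleftrightarrow> P y)"

definition subset :: "'v \<Rightarrow> 'v \<Rightarrow> bool" where
  "subset x y \<longleftrightarrow> (\<forall>z. z \<epsilon> x \<longrightarrow> z \<epsilon> y)"

definition pow :: "'v \<Rightarrow> 'v" where
  "pow x = setof (\<lambda>y. subset y x)"

definition upair :: "'v \<Rightarrow> 'v \<Rightarrow> 'v" where
  "upair x y = setof (\<lambda>z. z = x \<or> z = y)"

definition opair :: "'v \<Rightarrow> 'v \<Rightarrow> 'v" where
  "opair x y = upair (upair x x) (upair x y)"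

definition zero :: 'v where
  "zero = setof (\<lambda>y. False)"

definition succ :: "'v \<Rightarrow> 'v" where
  "succ x = setof (\<lambda>y. y \<epsilon> x \<or> y = x)"

text \<open>In a nonstandard model \<open>omega\<close> has elements that are not of the form \<open>succ (\<dots> (succ zero))\<close>.\<close>

definition omega :: 'v where
  "omega = setof (\<lambda>n. \<forall>i. zero \<epsilon> i \<and> (\<forall>k. k \<epsilon> i \<longrightarrow> succ k \<epsilon> i) \<longrightarrow> n \<epsilon> i)"

definition is_fun :: "'v \<Rightarrow> 'v \<Rightarrow> 'v \<Rightarrow> bool" where
  "is_fun f x y \<longleftrightarrow>
     (\<forall>p. p \<epsilon> f \<longrightarrow> (\<exists>u w. u \<epsilon> x \<and> w \<epsilon> y \<and> p = opair u w)) \<and>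
     (\<forall>u. u \<epsilon> x \<longrightarrow> (\<exists>!w. opair u w \<epsilon> f))"

definition is_inj :: "'v \<Rightarrow> 'v \<Rightarrow> 'v \<Rightarrow> bool" where
  "is_inj f x y \<longleftrightarrow> is_fun f x y \<and>
     (\<forall>u u' w. opair u w \<epsilon> f \<longrightarrow> opair u' w \<epsilon> f \<longrightarrow> u = u')"

definition is_bij :: "'v \<Rightarrow> 'v \<Rightarrow> 'v \<Rightarrow> bool" where
  "is_bij f x y \<longleftrightarrow> is_inj f x y \<and> (\<forall>w. w \<epsilon> y \<longrightarrow> (\<exists>u. u \<epsilon> x \<and> opair u w \<epsilon> f))"

definition equinumerous :: "'v \<Rightarrow> 'v \<Rightarrow> bool" where
  "equinumerous x y \<longleftrightarrow> (\<exists>f. is_bij f x y)"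

definition is_finite :: "'v \<Rightarrow> bool" where
  "is_finite x \<longleftrightarrow> (\<exists>n. n \<epsilon> omega \<and> equinumerous x n)"

definition fin :: "'v \<Rightarrow> 'v" where
  "fin x = setof (\<lambda>y. subset y x \<and> is_finite y)"

definition seq :: "'v \<Rightarrow> 'v" where
  "seq x = setof (\<lambda>s. \<exists>n. n \<epsilon> omega \<and> is_fun s n x)"

definition seq_inj :: "'v \<Rightarrow> 'v" where
  "seq_inj x = setof (\<lambda>s. \<exists>n. n \<epsilon> omega \<and> is_inj s n x)"

text \<open>
  \<open>fin_iter m x\<close> is the \<open>m\<close>-fold iterate of \<open>fin\<close> at \<open>x\<close>, by recursion on \<open>m \<in> \<omega>\<close> inside the model:
  \<open>g\<close> is the sequence \<open>\<langle>x, fin x, \<dots>, fin\<^sup>m x\<rangle>\<close>. The number \<open>m\<close> is an element of the model and not an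
  HOL number, since it is a variable of ZF.
\<close>

definition fin_iter :: "'v \<Rightarrow> 'v \<Rightarrow> 'v" where
  "fin_iter m x = (THE y. \<exists>g c. is_fun g (succ m) c \<and> opair zero x \<epsilon> g \<and>
     (\<forall>k z. k \<epsilon> m \<longrightarrow> opair k z \<epsilon> g \<longrightarrow> opair (succ k) (fin z) \<epsilon> g) \<and> opair m y \<epsilon> g)"

section \<open>Cardinals of a model\<close>

text \<open>
  The only property of cardinalities that matters is that \<open>|x| = |y|\<close> iff \<open>x\<close> and \<open>y\<close> are in
  bijection. Scott's trick serves to have a set with this property; here, \<open>|x|\<close> is the whole
  equinumerosity class, as an HOL set of elements of the model.
\<close>

definition cardinality :: "'v \<Rightarrow> 'v set" where
  "cardinality x = {y. equinumerous y x}"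

definition infinite_cardinal :: "'v set \<Rightarrow> bool" where
  "infinite_cardinal \<aa> \<longleftrightarrow> (\<exists>x. \<aa> = cardinality x \<and> \<not> is_finite x)"

text \<open>
  The operation on cardinals induced by an operation \<open>F\<close> on sets, \<open>F |x| = |F x|\<close>. The union is of
  equal sets if \<open>F\<close> respects equinumerosity.
\<close>

definition card_op :: "('v \<Rightarrow> 'v) \<Rightarrow> 'v set \<Rightarrow> 'v set" where
  "card_op F \<aa> = (\<Union>x\<in>\<aa>. cardinality (F x))"

definition card_two_exp :: "'v set \<Rightarrow> 'v set" where
  "card_two_exp = card_op pow"

definition card_seq :: "'v set \<Rightarrow> 'v set" where
  "card_seq = card_op seq"

definition card_seq_inj :: "'v set \<Rightarrow> 'v set" where
  "card_seq_inj = card_op seq_inj"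

definition card_fin_iter :: "'v \<Rightarrow> 'v set \<Rightarrow> 'v set" where
  "card_fin_iter m = card_op (fin_iter m)"

end

end

theory Submission
  imports Defs
begin

text \<open>
  Write \<open>X \<rightarrow> Y\<close> when some function maps a subset of \<open>X\<close> onto a superset of \<open>Y\<close> (\<open>covers X Y\<close> below).
  Taking preimages turns \<open>X \<rightarrow> Y\<close> into an injection of the power set of \<open>Y\<close> into the power set of \<open>X\<close>,
  so by the Cantor--Bernstein theorem, which does not depend on choice, the power sets of \<open>X\<close> and \<open>Y\<close> are
  equinumerous as soon as \<open>X \<rightarrow> Y\<close> and \<open>Y \<rightarrow> X\<close>. For infinite \<open>x\<close> all the sets of the theorem lie
  in one class of this equivalence. Two of the required coverings have content.

  First, \<open>fin (fin x) \<rightarrow> seq_inj x\<close>: an injective sequence is recovered from the finite chain of the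
  ranges of its initial segments. Since \<open>fin z \<rightarrow> z\<close>, it follows that \<open>fin\<^sup>m x \<rightarrow> seq_inj x\<close> for
  all \<open>m \<ge> 2\<close>.

  Second, \<open>seq_inj x \<rightarrow> fin (seq x)\<close>. A finite set \<open>Q\<close> of finite sequences in \<open>x\<close> has the form
  \<open>{s \<circ> p | p \<in> P}\<close> for a finite set \<open>P\<close> of finite sequences of natural numbers and a single injective
  sequence \<open>s\<close> whose values include all entries of members of \<open>Q\<close>. Because \<open>x\<close> is infinite, \<open>s\<close> can be
  prolonged to any greater length, and the length of \<open>s\<close> is then free to carry a code of \<open>P\<close>: all that is
  needed is a function on \<open>\<omega>\<close> that takes every value \<open>P \<in> fin (seq \<omega>)\<close> at arbitrarily large
  arguments. With such a function \<open>e\<close>, the sequence \<open>s\<close> is sent to \<open>{s \<circ> p | p \<in> e (length s)}\<close>.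
  From this and \<open>seq_inj x \<subseteq> seq x\<close>, if \<open>seq_inj x \<rightarrow> z\<close>, then
  \<open>seq_inj x \<rightarrow> fin (seq x) \<rightarrow> fin z\<close>. Hence \<open>seq_inj x \<rightarrow> fin\<^sup>m x\<close> for all \<open>m\<close>, by induction, and also
  \<open>seq_inj x \<rightarrow> fin (seq x) \<rightarrow> seq x\<close>.

  The function \<open>e\<close> comes without arithmetic. Binary counting enumerates \<open>fin \<omega>\<close>, and as the functor
  \<open>fin\<close> preserves coverings, \<open>\<omega>\<close> covers every iterate of \<open>fin\<close> at \<open>\<omega>\<close>; a finite sequence of
  natural numbers is a finite set of ordered pairs, so that \<open>seq \<omega> \<subseteq> fin (fin (fin \<omega>))\<close>. The
  \<open>n\<close>-th finite set in the binary count is a subset of \<open>n\<close>, and reading off its least element yields a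
  sequence of natural numbers that takes each value at arbitrarily large arguments.

  All this happens inside a model in which Separation is available for formulas only.
  Every predicate that is used to form a set or to do induction over \<open>\<omega>\<close> must therefore be shown to be
  definable from parameters; the rules collected under \<open>definability\<close> do this by following the syntax of
  the predicate. As \<open>\<omega>\<close> may be nonstandard, recursion and induction, also over \<open>m\<close>, are internal.
\<close>

section \<open>Definability\<close>

primrec rename :: "(nat \<Rightarrow> nat) \<Rightarrow> fm \<Rightarrow> fm" where
  "rename \<rho> (Mem i j) = Mem (\<rho> i) (\<rho> j)"
| "rename \<rho> (Eq i j) = Eq (\<rho> i) (\<rho> j)"
| "rename \<rho> (Neg p) = Neg (rename \<rho> p)"
| "rename \<rho> (Conj p q) = Conj (rename \<rho> p) (rename \<rho> q)"
| "rename \<rho> (All p) = All (rename (case_nat 0 (\<lambda>i. Suc (\<rho> i))) p)"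

lemma sat_rename: "sat E v (rename \<rho> \<phi>) \<longleftrightarrow> sat E (\<lambda>i. v (\<rho> i)) \<phi>"
proof (induction \<phi> arbitrary: v \<rho>)
  case (All \<phi>)
  have "(\<lambda>i. case_nat x v (case_nat 0 (\<lambda>i. Suc (\<rho> i)) i)) = case_nat x (\<lambda>i. v (\<rho> i))" for x
    by (auto split: nat.split)
  then show ?case
    by (simp add: All)
qed simp_all

text \<open>
  A map \<open>\<sigma>\<close> assigns to each variable of a formula either a variable of the surrounding context or a
  fixed element of the model. This treats parameters and context variables alike, which makes merging the
  parameters of two formulas a matter of renaming.
\<close>

definition valuation_with :: "(nat \<Rightarrow> nat + 'v) \<Rightarrow> (nat \<Rightarrow> 'v) \<Rightarrow> nat \<Rightarrow> 'v" where
  "valuation_with \<sigma> v i = case_sum v (\<lambda>c. c) (\<sigma> i)"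

definition definable :: "('v \<Rightarrow> 'v \<Rightarrow> bool) \<Rightarrow> ((nat \<Rightarrow> 'v) \<Rightarrow> bool) \<Rightarrow> bool" where
  "definable E P \<longleftrightarrow> (\<exists>\<phi> \<sigma>. \<forall>v. P v \<longleftrightarrow> sat E (valuation_with \<sigma> v) \<phi>)"

text \<open>
  A term is represented by its graph, with the value of the term as variable \<open>0\<close>.
\<close>

definition definable_term :: "('v \<Rightarrow> 'v \<Rightarrow> bool) \<Rightarrow> ((nat \<Rightarrow> 'v) \<Rightarrow> 'v) \<Rightarrow> bool" where
  "definable_term E t \<longleftrightarrow> definable E (\<lambda>v. v 0 = t (\<lambda>i. v (Suc i)))"

context ZF_model
begin

abbreviation "D \<equiv> definable E"
abbreviation "DT \<equiv> definable_term E"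

lemma definable_atom: "D (\<lambda>v. v i \<epsilon> v j)" "D (\<lambda>v. v i = v j)" "D (\<lambda>v. v i = c)"
proof -
  have "v i \<epsilon> v j \<longleftrightarrow> sat E (valuation_with Inl v) (Mem i j)"
    "v i = v j \<longleftrightarrow> sat E (valuation_with Inl v) (Eq i j)"
    "v i = c \<longleftrightarrow> sat E (valuation_with (case_nat (Inl i) (\<lambda>_. Inr c)) v) (Eq 0 1)" for v
    by (simp_all add: valuation_with_def)
  then show "D (\<lambda>v. v i \<epsilon> v j)" "D (\<lambda>v. v i = v j)" "D (\<lambda>v. v i = c)"
    unfolding definable_def by blast+
qed

lemma definable_rename:
  assumes "D P"
  shows "D (\<lambda>v. P (\<lambda>i. v (\<rho> i)))"
proof -
  obtain \<phi> \<sigma> where P: "\<And>v. P v \<longleftrightarrow> sat E (valuation_with \<sigma> v) \<phi>"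
    using assms by (auto simp: definable_def)
  have "valuation_with \<sigma> (\<lambda>i. v (\<rho> i)) = valuation_with (\<lambda>i. map_sum \<rho> (\<lambda>c. c) (\<sigma> i)) v" for v
    by (auto simp: valuation_with_def fun_eq_iff split: sum.split)
  then show ?thesis
    unfolding definable_def by (intro exI) (auto simp: P)
qed

lemma definable_not:
  assumes "D P"
  shows "D (\<lambda>v. \<not> P v)"
proof -
  obtain \<phi> \<sigma> where P: "\<And>v. P v \<longleftrightarrow> sat E (valuation_with \<sigma> v) \<phi>"
    using assms by (auto simp: definable_def)
  show ?thesis
    unfolding definable_def by (rule exI[of _ "Neg \<phi>"]) (auto simp: P)
qed

text \<open>
  The variables of the two formulas are made disjoint by sending them to the even and the odd indices.
\<close>

lemma definable_conj:
  assumes "D P" "D Q"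
  shows "D (\<lambda>v. P v \<and> Q v)"
proof -
  obtain \<phi> \<sigma> where P: "\<And>v. P v \<longleftrightarrow> sat E (valuation_with \<sigma> v) \<phi>"
    using assms by (auto simp: definable_def)
  obtain \<psi> \<tau> where Q: "\<And>v. Q v \<longleftrightarrow> sat E (valuation_with \<tau> v) \<psi>"
    using assms by (auto simp: definable_def)
  define \<theta> where "\<theta> i = (if even i then \<sigma> (i div 2) else \<tau> (i div 2))" for i
  have "(\<lambda>i. valuation_with \<theta> v (2 * i)) = valuation_with \<sigma> v"
    "(\<lambda>i. valuation_with \<theta> v (Suc (2 * i))) = valuation_with \<tau> v" for v
    by (auto simp: valuation_with_def \<theta>_def)
  then have "P v \<and> Q v \<longleftrightarrow> sat E (valuation_with \<theta> v)
      (Conj (rename (\<lambda>i. 2 * i) \<phi>) (rename (\<lambda>i. Suc (2 * i)) \<psi>))" for v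
    by (simp add: sat_rename P Q)
  then show ?thesis
    unfolding definable_def by blast
qed

text \<open>
  Several variables of the formula may denote the bound variable of the context; all of them are identified
  with the variable that the quantifier binds, and the others move up by one.
\<close>

lemma definable_all:
  assumes "D (\<lambda>v. P (v 0) (\<lambda>i. v (Suc i)))"
  shows "D (\<lambda>v. \<forall>x. P x v)"
proof -
  obtain \<phi> \<sigma> where P: "\<And>v. P (v 0) (\<lambda>i. v (Suc i)) \<longleftrightarrow> sat E (valuation_with \<sigma> v) \<phi>"
    using assms by (auto simp: definable_def)
  define \<rho> where "\<rho> i = (if \<sigma> i = Inl 0 then 0 else Suc i)" for i
  define \<tau> where "\<tau> i = (case \<sigma> i of Inl j \<Rightarrow> Inl (j - 1) | Inr c \<Rightarrow> Inr c)" for i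
  have "(\<lambda>i. case_nat x (valuation_with \<tau> v) (\<rho> i)) = valuation_with \<sigma> (case_nat x v)" for x v
    by (auto simp: valuation_with_def \<rho>_def \<tau>_def fun_eq_iff split: sum.split nat.split)
  then have "(\<forall>x. P x v) \<longleftrightarrow> sat E (valuation_with \<tau> v) (All (rename \<rho> \<phi>))" for v
    using P[of "case_nat x v" for x] by (simp add: sat_rename)
  then show ?thesis
    unfolding definable_def by blast
qed

text \<open>
  Backward application of these rules proves definability by following the syntax of a predicate. In
  the quantifier rules the bound variable becomes \<open>v 0\<close> and every other index is shifted by one.
\<close>

named_theorems definability

lemma definable_disj:
  assumes "D P" "D Q"
  shows "D (\<lambda>v. P v \<or> Q v)"
proof -
  have "D (\<lambda>v. \<not> (\<not> P v \<and> \<not> Q v))"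
    using assms by (intro definable_not definable_conj)
  then show ?thesis
    by simp
qed

lemma definable_imp:
  assumes "D P" "D Q"
  shows "D (\<lambda>v. P v \<longrightarrow> Q v)"
  unfolding imp_conv_disj using assms by (intro definable_not definable_disj)

lemma definable_iff:
  assumes "D P" "D Q"
  shows "D (\<lambda>v. P v \<longleftrightarrow> Q v)"
  unfolding iff_conv_conj_imp using assms by (intro definable_conj definable_imp)

lemma definable_ex:
  assumes "D (\<lambda>v. P (v 0) (\<lambda>i. v (Suc i)))"
  shows "D (\<lambda>v. \<exists>x. P x v)"
proof -
  have "D (\<lambda>v. \<not> (\<forall>x. \<not> P x v))"
    using assms by (intro definable_not definable_all)
  then show ?thesis
    by simp
qed

lemma definable_const: "D (\<lambda>v. Q)"
proof -
  have "D (\<lambda>v. v 0 = v 0)"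
    by (rule definable_atom)
  moreover have "D (\<lambda>v. \<not> v 0 = v 0)"
    by (rule definable_not[OF definable_atom(2)])
  ultimately show ?thesis
    by (cases Q) simp_all
qed

lemma definable_term_var: "DT (\<lambda>v. v i)"
  unfolding definable_term_def by (rule definable_atom)

lemma definable_term_const: "DT (\<lambda>v. c)"
  unfolding definable_term_def by (rule definable_atom)

text \<open>
  A definable term may be substituted for a variable: quantify over its value.
\<close>

lemma definable_bind:
  assumes "DT t" "D (\<lambda>v. P (v 0) (\<lambda>i. v (Suc i)))"
  shows "D (\<lambda>v. P (t v) v)"
proof -
  have "D (\<lambda>v. \<exists>x. x = t v \<and> P x v)"
    using assms unfolding definable_term_def by (intro definable_ex definable_conj)
  then show ?thesis
    by simp
qed

lemma definable_term_shift:
  assumes "DT t"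
  shows "DT (\<lambda>v. t (\<lambda>i. v (Suc i)))"
  using definable_rename[OF assms[unfolded definable_term_def], of "case_nat 0 (\<lambda>i. Suc (Suc i))"]
  unfolding definable_term_def by simp

lemma definable_subst1:
  assumes "D (\<lambda>v. P (v 0))" "DT s"
  shows "D (\<lambda>v. P (s v))"
  by (rule definable_bind) (use assms in auto)

lemma definable_subst2:
  assumes "D (\<lambda>v. P (v 0) (v 1))" "DT s" "DT t"
  shows "D (\<lambda>v. P (s v) (t v))"
proof (rule definable_bind[OF assms(2)], rule definable_bind[OF definable_term_shift[OF assms(3)]])
  show "D (\<lambda>v. P (v (Suc 0)) (v 0))"
    using definable_rename[OF assms(1), of "\<lambda>i. 1 - i"] by simp
qed

lemma definable_subst3:
  assumes "D (\<lambda>v. P (v 0) (v 1) (v 2))" "DT s" "DT t" "DT u"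
  shows "D (\<lambda>v. P (s v) (t v) (u v))"
proof (rule definable_bind[OF assms(2)], rule definable_bind[OF definable_term_shift[OF assms(3)]],
    rule definable_bind[OF definable_term_shift[OF definable_term_shift[OF assms(4)]]])
  show "D (\<lambda>v. P (v (Suc (Suc 0))) (v (Suc 0)) (v 0))"
    using definable_rename[OF assms(1), of "\<lambda>i. 2 - i"] by (simp add: numeral_2_eq_2)
qed

lemma definable_term_subst1:
  assumes "DT (\<lambda>v. F (v 0))" "DT s"
  shows "DT (\<lambda>v. F (s v))"
proof -
  have "D (\<lambda>v. v 0 = F (v 1))"
    using assms(1) unfolding definable_term_def by simp
  then show ?thesis
    unfolding definable_term_def[of _ "\<lambda>v. F (s v)"]
    by (rule definable_subst2[OF _ definable_term_var definable_term_shift[OF assms(2)]])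
qed

lemma definable_term_subst2:
  assumes "DT (\<lambda>v. F (v 0) (v 1))" "DT s" "DT t"
  shows "DT (\<lambda>v. F (s v) (t v))"
proof -
  have "D (\<lambda>v. v 0 = F (v 1) (v 2))"
    using assms(1) unfolding definable_term_def by (simp add: numeral_2_eq_2)
  then show ?thesis
    unfolding definable_term_def[of _ "\<lambda>v. F (s v) (t v)"]
    by (rule definable_subst3[OF _ definable_term_var definable_term_shift[OF assms(2)]
          definable_term_shift[OF assms(3)]])
qed

lemma definable_mem: "DT s \<Longrightarrow> DT t \<Longrightarrow> D (\<lambda>v. s v \<epsilon> t v)"
  by (rule definable_subst2[where P = "(\<epsilon>)", OF definable_atom(1)])

lemma definable_eq: "DT s \<Longrightarrow> DT t \<Longrightarrow> D (\<lambda>v. s v = t v)"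
  by (rule definable_subst2[where P = "(=)", OF definable_atom(2)])

lemmas definable_intros [definability] =
  definable_const definable_term_const definable_term_var definable_not definable_conj
  definable_disj definable_imp definable_iff definable_all definable_ex definable_mem definable_eq

lemma definable_ex1 [definability]:
  assumes "D (\<lambda>v. P (v 0) (\<lambda>i. v (Suc i)))"
  shows "D (\<lambda>v. \<exists>!x. P x v)"
proof -
  have "D (\<lambda>v. P (v 0) (\<lambda>i. v (Suc (Suc i))))"
    using definable_rename[OF assms, of "case_nat 0 (\<lambda>i. Suc (Suc i))"] by simp
  then show ?thesis
    unfolding Ex1_def using assms by (intro definability)
qed

text \<open>
  By extensionality, a set-valued term is definable as soon as membership in its value is.
\<close>

lemma definable_termI:
  assumes "\<And>v z. z \<epsilon> F v \<longleftrightarrow> P z v" "D (\<lambda>v. P (v 0) (\<lambda>i. v (Suc i)))"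
  shows "DT F"
proof -
  have "D (\<lambda>v. P (v 0) (\<lambda>i. v (Suc (Suc i))))"
    using definable_rename[OF assms(2), of "case_nat 0 (\<lambda>i. Suc (Suc i))"] by simp
  then have "D (\<lambda>v. \<forall>z. z \<epsilon> v 0 \<longleftrightarrow> P z (\<lambda>i. v (Suc i)))"
    by (intro definability)
  moreover have "v 0 = F (\<lambda>i. v (Suc i)) \<longleftrightarrow> (\<forall>z. z \<epsilon> v 0 \<longleftrightarrow> P z (\<lambda>i. v (Suc i)))" for v
    using extensionality[of "v 0" "F (\<lambda>i. v (Suc i))"] assms(1) by auto
  ultimately show ?thesis
    unfolding definable_term_def by simp
qed

text \<open>
  The variables that \<open>\<sigma>\<close> sends to the argument of \<open>P\<close> become variable \<open>0\<close>; the remaining ones are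
  constants, which the parameter valuation of the axiom scheme supplies, or context variables without influence
  on \<open>P\<close>, for which any value will do, here \<open>x\<close>.
\<close>

lemma separation_definable:
  assumes "D (\<lambda>v. P (v 0))"
  shows "\<exists>y. \<forall>z. z \<epsilon> y \<longleftrightarrow> z \<epsilon> x \<and> P z"
proof -
  obtain \<phi> \<sigma> where P: "\<And>v. P (v 0) \<longleftrightarrow> sat E (valuation_with \<sigma> v) \<phi>"
    using assms by (auto simp: definable_def)
  define \<rho> where "\<rho> i = (if \<sigma> i = Inl 0 then 0 else Suc i)" for i
  have "(\<lambda>i. case_nat z (valuation_with \<sigma> (\<lambda>_. x)) (\<rho> i)) = valuation_with \<sigma> (case_nat z (\<lambda>_. x))" for z
    by (auto simp: valuation_with_def \<rho>_def fun_eq_iff split: sum.split nat.split)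
  then have "P z \<longleftrightarrow> sat E (case_nat z (valuation_with \<sigma> (\<lambda>_. x))) (rename \<rho> \<phi>)" for z
    using P[of "case_nat z (\<lambda>_. x)"] by (simp add: sat_rename)
  then show ?thesis
    using separation[of x "valuation_with \<sigma> (\<lambda>_. x)" "rename \<rho> \<phi>"] by simp
qed

section \<open>Sets and pairs\<close>

abbreviation empty_set ("\<emptyset>") where "\<emptyset> \<equiv> zero E"
abbreviation omega_set ("\<omega>") where "\<omega> \<equiv> omega E"
abbreviation subset_of (infix "\<sqsubseteq>" 50) where "x \<sqsubseteq> y \<equiv> subset E x y"
abbreviation pair ("\<langle>_,/ _\<rangle>") where "\<langle>x, y\<rangle> \<equiv> opair E x y"
abbreviation equi (infix "\<approx>" 50) where "x \<approx> y \<equiv> equinumerous E x y"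

definition adjoin :: "'v \<Rightarrow> 'v \<Rightarrow> 'v" where
  "adjoin a A = setof E (\<lambda>z. z \<epsilon> A \<or> z = a)"

definition big_union :: "'v \<Rightarrow> 'v" where
  "big_union A = setof E (\<lambda>z. \<exists>y. y \<epsilon> A \<and> z \<epsilon> y)"

definition bin_union :: "'v \<Rightarrow> 'v \<Rightarrow> 'v" where
  "bin_union A B = setof E (\<lambda>z. z \<epsilon> A \<or> z \<epsilon> B)"

definition rel_image :: "'v \<Rightarrow> 'v \<Rightarrow> 'v" where
  "rel_image f A = setof E (\<lambda>y. \<exists>x. x \<epsilon> A \<and> \<langle>x, y\<rangle> \<epsilon> f)"

lemma set_eqI: "(\<And>z. z \<epsilon> x \<longleftrightarrow> z \<epsilon> y) \<Longrightarrow> x = y"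
  by (simp add: extensionality)

lemma mem_setof:
  assumes "\<exists>y. \<forall>z. z \<epsilon> y \<longleftrightarrow> P z"
  shows "z \<epsilon> setof E P \<longleftrightarrow> P z"
proof -
  obtain y where y: "\<forall>z. z \<epsilon> y \<longleftrightarrow> P z"
    using assms by blast
  then have "setof E P = y"
    unfolding setof_def by (intro the_equality) (auto intro: set_eqI)
  then show ?thesis
    using y by simp
qed

text \<open>
  This is how a notion introduced as the set of all \<open>z\<close> with \<open>P z\<close> gets its expected elements:
  it suffices to bound the definable class by some set.
\<close>

lemma mem_setof_bounded:
  assumes "D (\<lambda>v. P (v 0))" "\<And>z. P z \<Longrightarrow> z \<epsilon> x"
  shows "z \<epsilon> setof E P \<longleftrightarrow> P z"
proof (rule mem_setof)
  show "\<exists>y. \<forall>z. z \<epsilon> y \<longleftrightarrow> P z"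
    using separation_definable[OF assms(1), of x] assms(2) by metis
qed

lemma subset_iff: "x \<sqsubseteq> y \<longleftrightarrow> (\<forall>z. z \<epsilon> x \<longrightarrow> z \<epsilon> y)"
  by (simp add: subset_def)

lemma subset_refl: "x \<sqsubseteq> x"
  by (simp add: subset_iff)

lemma mem_upair [simp]: "z \<epsilon> upair E x y \<longleftrightarrow> z = x \<or> z = y"
  unfolding upair_def by (rule mem_setof) (rule pairing)

lemma mem_pow [simp]: "z \<epsilon> pow E x \<longleftrightarrow> z \<sqsubseteq> x"
  unfolding pow_def by (rule mem_setof) (use power_set in \<open>simp add: subset_iff\<close>)

lemma mem_big_union [simp]: "z \<epsilon> big_union A \<longleftrightarrow> (\<exists>y. y \<epsilon> A \<and> z \<epsilon> y)"
  unfolding big_union_def by (rule mem_setof) (rule union)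

lemma mem_bin_union [simp]: "z \<epsilon> bin_union A B \<longleftrightarrow> z \<epsilon> A \<or> z \<epsilon> B"
  unfolding bin_union_def by (rule mem_setof) (rule exI[of _ "big_union (upair E A B)"], auto)

lemma mem_adjoin [simp]: "z \<epsilon> adjoin a A \<longleftrightarrow> z \<epsilon> A \<or> z = a"
  unfolding adjoin_def by (rule mem_setof) (rule exI[of _ "bin_union A (upair E a a)"], auto)

lemma mem_zero [simp]: "\<not> z \<epsilon> \<emptyset>"
proof -
  have "z \<epsilon> \<emptyset> \<longleftrightarrow> False"
    unfolding zero_def by (rule mem_setof) (use infinity in blast)
  then show ?thesis
    by simp
qed

lemma mem_succ [simp]: "z \<epsilon> succ E x \<longleftrightarrow> z \<epsilon> x \<or> z = x"
  unfolding succ_def by (rule mem_setof) (rule exI[of _ "adjoin x x"], simp)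

lemma upair_eq_iff: "upair E a b = upair E c d \<longleftrightarrow> (a = c \<and> b = d) \<or> (a = d \<and> b = c)"
proof
  assume eq: "upair E a b = upair E c d"
  have "z = a \<or> z = b \<longleftrightarrow> z = c \<or> z = d" for z
    using arg_cong[OF eq, of "\<lambda>x. z \<epsilon> x"] by simp
  then show "(a = c \<and> b = d) \<or> (a = d \<and> b = c)"
    by metis
qed (auto intro: set_eqI)

lemma opair_eq_iff [simp]: "\<langle>a, b\<rangle> = \<langle>c, d\<rangle> \<longleftrightarrow> a = c \<and> b = d"
  unfolding opair_def upair_eq_iff by auto

lemma definable_subset [definability]: "DT s \<Longrightarrow> DT t \<Longrightarrow> D (\<lambda>v. s v \<sqsubseteq> t v)"
  by (rule definable_subst2[where P = "subset E"], unfold subset_def) (intro definability)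

lemma definable_upair [definability]: "DT s \<Longrightarrow> DT t \<Longrightarrow> DT (\<lambda>v. upair E (s v) (t v))"
  by (rule definable_term_subst2[where F = "upair E"], rule definable_termI, rule mem_upair) (intro definability)

lemma definable_opair [definability]: "DT s \<Longrightarrow> DT t \<Longrightarrow> DT (\<lambda>v. \<langle>s v, t v\<rangle>)"
  unfolding opair_def by (intro definability)

lemma definable_big_union [definability]: "DT s \<Longrightarrow> DT (\<lambda>v. big_union (s v))"
  by (rule definable_term_subst1[where F = big_union], rule definable_termI, rule mem_big_union) (intro definability)

lemma definable_bin_union [definability]: "DT s \<Longrightarrow> DT t \<Longrightarrow> DT (\<lambda>v. bin_union (s v) (t v))"
  by (rule definable_term_subst2[where F = bin_union], rule definable_termI, rule mem_bin_union) (intro definability)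

lemma definable_succ [definability]: "DT s \<Longrightarrow> DT (\<lambda>v. succ E (s v))"
  by (rule definable_term_subst1[where F = "succ E"], rule definable_termI, rule mem_succ) (intro definability)

lemma pair_mem_fields: "\<langle>x, y\<rangle> \<epsilon> f \<Longrightarrow> x \<epsilon> big_union (big_union f) \<and> y \<epsilon> big_union (big_union f)"
  unfolding opair_def mem_big_union using mem_upair by metis

lemma mem_rel_image [simp]: "y \<epsilon> rel_image f A \<longleftrightarrow> (\<exists>x. x \<epsilon> A \<and> \<langle>x, y\<rangle> \<epsilon> f)"
  unfolding rel_image_def
proof (rule mem_setof_bounded[where x = "big_union (big_union f)"])
  show "D (\<lambda>v. \<exists>x. x \<epsilon> A \<and> \<langle>x, v 0\<rangle> \<epsilon> f)"
    by (intro definability)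
qed (use pair_mem_fields in blast)

lemma definable_rel_image [definability]: "DT s \<Longrightarrow> DT t \<Longrightarrow> DT (\<lambda>v. rel_image (s v) (t v))"
  by (rule definable_term_subst2[where F = rel_image], rule definable_termI, rule mem_rel_image) (intro definability)

lemma product_exists: "\<exists>c. \<forall>p. p \<epsilon> c \<longleftrightarrow> (\<exists>x y. x \<epsilon> A \<and> y \<epsilon> B \<and> p = \<langle>x, y\<rangle>)"
proof -
  have "D (\<lambda>v. \<exists>x y. x \<epsilon> A \<and> y \<epsilon> B \<and> v 0 = \<langle>x, y\<rangle>)"
    by (intro definability)
  from separation_definable[OF this, of "pow E (pow E (bin_union A B))"]
  obtain c where "\<forall>p. p \<epsilon> c \<longleftrightarrow> p \<epsilon> pow E (pow E (bin_union A B)) \<and> (\<exists>x y. x \<epsilon> A \<and> y \<epsilon> B \<and> p = \<langle>x, y\<rangle>)"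
    by blast
  moreover have "\<langle>x, y\<rangle> \<epsilon> pow E (pow E (bin_union A B))" if "x \<epsilon> A" "y \<epsilon> B" for x y
    using that by (auto simp: opair_def subset_iff)
  ultimately have "\<forall>p. p \<epsilon> c \<longleftrightarrow> (\<exists>x y. x \<epsilon> A \<and> y \<epsilon> B \<and> p = \<langle>x, y\<rangle>)"
    by blast
  then show ?thesis
    by blast
qed

lemma productE:
  obtains c where "\<And>p. p \<epsilon> c \<longleftrightarrow> (\<exists>x y. x \<epsilon> A \<and> y \<epsilon> B \<and> p = \<langle>x, y\<rangle>)"
  using product_exists[of A B] by blast

text \<open>
  This turns a definable relation into a set of pairs, as the notions of bijection and covering require.
\<close>

lemma graph_exists:
  assumes "D (\<lambda>v. R (v 0) (v 1))"
  shows "\<exists>f. \<forall>p. p \<epsilon> f \<longleftrightarrow> (\<exists>x y. x \<epsilon> A \<and> y \<epsilon> B \<and> R x y \<and> p = \<langle>x, y\<rangle>)"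
proof -
  obtain c where c: "\<And>p. p \<epsilon> c \<longleftrightarrow> (\<exists>x y. x \<epsilon> A \<and> y \<epsilon> B \<and> p = \<langle>x, y\<rangle>)"
    by (rule productE[of A B]) blast
  have "D (\<lambda>v. \<exists>x y. R x y \<and> v 0 = \<langle>x, y\<rangle>)"
    by (intro definability definable_subst2[OF assms])
  from separation_definable[OF this, of c]
  obtain f where "\<forall>p. p \<epsilon> f \<longleftrightarrow> p \<epsilon> c \<and> (\<exists>x y. R x y \<and> p = \<langle>x, y\<rangle>)"
    by blast
  then have "\<forall>p. p \<epsilon> f \<longleftrightarrow> (\<exists>x y. x \<epsilon> A \<and> y \<epsilon> B \<and> R x y \<and> p = \<langle>x, y\<rangle>)"
    by (auto simp: c)
  then show ?thesis
    by blast
qed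

lemma separationE:
  assumes "D (\<lambda>v. P (v 0))"
  obtains y where "\<And>z. z \<epsilon> y \<longleftrightarrow> z \<epsilon> x \<and> P z"
  using separation_definable[OF assms, of x] by blast

lemma foundation_max:
  assumes "y \<epsilon> x"
  obtains y where "y \<epsilon> x" "\<And>z. z \<epsilon> x \<Longrightarrow> \<not> z \<epsilon> y"
  using foundation[of x] assms by blast

lemma mem_irrefl [simp]: "\<not> x \<epsilon> x"
  using foundation_max[of x "upair E x x"] by auto

lemma mem_asym: "x \<epsilon> y \<Longrightarrow> \<not> y \<epsilon> x"
  using foundation_max[of x "upair E x y"] by auto

section \<open>Natural numbers\<close>

lemma mem_omega: "n \<epsilon> \<omega> \<longleftrightarrow> (\<forall>i. \<emptyset> \<epsilon> i \<and> (\<forall>k. k \<epsilon> i \<longrightarrow> succ E k \<epsilon> i) \<longrightarrow> n \<epsilon> i)"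
proof -
  obtain i e where "e \<epsilon> i" "\<forall>z. \<not> z \<epsilon> e"
    "\<forall>x. x \<epsilon> i \<longrightarrow> (\<exists>s. s \<epsilon> i \<and> (\<forall>z. z \<epsilon> s \<longleftrightarrow> z \<epsilon> x \<or> z = x))"
    using infinity by blast
  moreover have "s = succ E x" if "\<forall>z. z \<epsilon> s \<longleftrightarrow> z \<epsilon> x \<or> z = x" for s x
    using that by (auto intro: set_eqI)
  moreover have "e = \<emptyset>" if "\<forall>z. \<not> z \<epsilon> e" for e
    using that by (auto intro: set_eqI)
  ultimately have i: "\<emptyset> \<epsilon> i \<and> (\<forall>k. k \<epsilon> i \<longrightarrow> succ E k \<epsilon> i)"
    by metis
  show ?thesis
    unfolding omega_def
    by (rule mem_setof_bounded[where x = i], intro definability, use i in blast)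
qed

lemma zero_omega [simp]: "\<emptyset> \<epsilon> \<omega>"
  by (simp add: mem_omega)

lemma succ_omega [simp]: "n \<epsilon> \<omega> \<Longrightarrow> succ E n \<epsilon> \<omega>"
  by (simp add: mem_omega)

lemma omega_induct [consumes 1, case_names definable zero succ]:
  assumes "n \<epsilon> \<omega>" "D (\<lambda>v. P (v 0))" "P \<emptyset>" "\<And>n. n \<epsilon> \<omega> \<Longrightarrow> P n \<Longrightarrow> P (succ E n)"
  shows "P n"
proof -
  obtain i where i: "z \<epsilon> i \<longleftrightarrow> z \<epsilon> \<omega> \<and> P z" for z
    using separation_definable[OF assms(2), of \<omega>] by metis
  have "\<emptyset> \<epsilon> i \<and> (\<forall>k. k \<epsilon> i \<longrightarrow> succ E k \<epsilon> i)"
    by (simp add: i assms)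
  then show ?thesis
    using assms(1) i mem_omega by blast
qed

lemma omega_trans:
  assumes "n \<epsilon> \<omega>" "k \<epsilon> n"
  shows "k \<epsilon> \<omega>" "k \<sqsubseteq> n"
proof -
  have "\<forall>k. k \<epsilon> n \<longrightarrow> k \<epsilon> \<omega> \<and> k \<sqsubseteq> n"
    using assms(1)
  proof (induction rule: omega_induct)
    case definable
    show ?case by (intro definability)
  qed (auto simp: subset_iff)
  then show "k \<epsilon> \<omega>" "k \<sqsubseteq> n"
    using assms(2) by auto
qed

lemma omega_mem_trans: "n \<epsilon> \<omega> \<Longrightarrow> k \<epsilon> n \<Longrightarrow> j \<epsilon> k \<Longrightarrow> j \<epsilon> n"
  using omega_trans(2)[of n k] by (simp add: subset_iff)

lemma zero_mem_succ: "n \<epsilon> \<omega> \<Longrightarrow> \<emptyset> \<epsilon> succ E n"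
proof (induction rule: omega_induct)
  case definable
  show ?case by (intro definability)
qed auto

lemma succ_mem_succ:
  assumes "n \<epsilon> \<omega>" "k \<epsilon> n"
  shows "succ E k \<epsilon> succ E n"
proof -
  have "\<forall>k. k \<epsilon> n \<longrightarrow> succ E k \<epsilon> succ E n"
    using assms(1)
  proof (induction rule: omega_induct)
    case definable
    show ?case by (intro definability)
  next
    case (succ n)
    then show ?case by (metis mem_succ)
  qed simp
  then show ?thesis
    using assms(2) by simp
qed

lemma omega_linear:
  assumes "n \<epsilon> \<omega>" "m \<epsilon> \<omega>"
  shows "m \<epsilon> n \<or> m = n \<or> n \<epsilon> m"
  using assms(1)
proof (induction rule: omega_induct)
  case definable
  show ?case by (intro definability)
next
  case zero
  show ?case
    using zero_mem_succ[OF assms(2)] by auto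
next
  case (succ n)
  then show ?case
    using succ_mem_succ[OF assms(2), of n] by auto
qed

lemma is_funD:
  assumes "is_fun E f x y"
  shows "p \<epsilon> f \<Longrightarrow> \<exists>u w. u \<epsilon> x \<and> w \<epsilon> y \<and> p = \<langle>u, w\<rangle>"
    and "\<langle>u, w\<rangle> \<epsilon> f \<Longrightarrow> u \<epsilon> x" "\<langle>u, w\<rangle> \<epsilon> f \<Longrightarrow> w \<epsilon> y"
    and "\<langle>u, w\<rangle> \<epsilon> f \<Longrightarrow> \<langle>u, w'\<rangle> \<epsilon> f \<Longrightarrow> w = w'"
    and "u \<epsilon> x \<Longrightarrow> \<exists>w. \<langle>u, w\<rangle> \<epsilon> f"
proof -
  have graph: "\<And>p. p \<epsilon> f \<Longrightarrow> \<exists>u w. u \<epsilon> x \<and> w \<epsilon> y \<and> p = \<langle>u, w\<rangle>"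
    and total: "\<And>u. u \<epsilon> x \<Longrightarrow> \<exists>!w. \<langle>u, w\<rangle> \<epsilon> f"
    using assms unfolding is_fun_def by blast+
  show "p \<epsilon> f \<Longrightarrow> \<exists>u w. u \<epsilon> x \<and> w \<epsilon> y \<and> p = \<langle>u, w\<rangle>"
    by (rule graph)
  show dom: "\<langle>u, w\<rangle> \<epsilon> f \<Longrightarrow> u \<epsilon> x" for u w
    using graph by fastforce
  show "\<langle>u, w\<rangle> \<epsilon> f \<Longrightarrow> w \<epsilon> y"
    using graph by fastforce
  show "\<langle>u, w\<rangle> \<epsilon> f \<Longrightarrow> \<langle>u, w'\<rangle> \<epsilon> f \<Longrightarrow> w = w'"
    using dom total by blast
  show "u \<epsilon> x \<Longrightarrow> \<exists>w. \<langle>u, w\<rangle> \<epsilon> f"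
    using total by blast
qed

lemma is_funI:
  assumes "\<And>p. p \<epsilon> f \<Longrightarrow> \<exists>u w. u \<epsilon> x \<and> w \<epsilon> y \<and> p = \<langle>u, w\<rangle>"
    and "\<And>u. u \<epsilon> x \<Longrightarrow> \<exists>w. \<langle>u, w\<rangle> \<epsilon> f"
    and "\<And>u w w'. \<langle>u, w\<rangle> \<epsilon> f \<Longrightarrow> \<langle>u, w'\<rangle> \<epsilon> f \<Longrightarrow> w = w'"
  shows "is_fun E f x y"
  unfolding is_fun_def using assms by blast

lemma is_fun_domain_unique: "is_fun E f x y \<Longrightarrow> is_fun E f x' y' \<Longrightarrow> x = x'"
  by (intro set_eqI) (metis is_funD(2,5))

lemma is_injD:
  assumes "is_inj E f x y"
  shows "is_fun E f x y" "\<langle>u, w\<rangle> \<epsilon> f \<Longrightarrow> \<langle>u', w\<rangle> \<epsilon> f \<Longrightarrow> u = u'"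
  using assms unfolding is_inj_def by blast+

lemma definable_is_fun [definability]: "DT s \<Longrightarrow> DT t \<Longrightarrow> DT u \<Longrightarrow> D (\<lambda>v. is_fun E (s v) (t v) (u v))"
  by (rule definable_subst3[where P = "is_fun E"], unfold is_fun_def) (intro definability)

lemma definable_is_inj [definability]: "DT s \<Longrightarrow> DT t \<Longrightarrow> DT u \<Longrightarrow> D (\<lambda>v. is_inj E (s v) (t v) (u v))"
  by (rule definable_subst3[where P = "is_inj E"], unfold is_inj_def) (intro definability)

lemma definable_is_bij [definability]: "DT s \<Longrightarrow> DT t \<Longrightarrow> DT u \<Longrightarrow> D (\<lambda>v. is_bij E (s v) (t v) (u v))"
  by (rule definable_subst3[where P = "is_bij E"], unfold is_bij_def) (intro definability)

lemma definable_equinumerous [definability]: "DT s \<Longrightarrow> DT t \<Longrightarrow> D (\<lambda>v. s v \<approx> t v)"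
  by (rule definable_subst2[where P = "equinumerous E"], unfold equinumerous_def) (intro definability)

lemma definable_is_finite [definability]: "DT s \<Longrightarrow> D (\<lambda>v. is_finite E (s v))"
  by (rule definable_subst1[where P = "is_finite E"], unfold is_finite_def) (intro definability)

lemma mem_fin [simp]: "y \<epsilon> fin E x \<longleftrightarrow> y \<sqsubseteq> x \<and> is_finite E y"
  unfolding fin_def by (rule mem_setof_bounded[where x = "pow E x"], intro definability) simp

lemma is_fun_bounded: "\<exists>c. \<forall>f d. d \<sqsubseteq> x \<longrightarrow> is_fun E f d y \<longrightarrow> f \<epsilon> c"
proof -
  obtain c where c: "\<And>p. p \<epsilon> c \<longleftrightarrow> (\<exists>u w. u \<epsilon> x \<and> w \<epsilon> y \<and> p = \<langle>u, w\<rangle>)"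
    by (rule productE[of x y]) blast
  have "f \<epsilon> pow E c" if "d \<sqsubseteq> x" "is_fun E f d y" for f d
    using that is_funD(1)[OF that(2)] c unfolding mem_pow subset_iff by metis
  then show ?thesis
    by blast
qed

lemma omega_subset: "n \<epsilon> \<omega> \<Longrightarrow> n \<sqsubseteq> \<omega>"
  using omega_trans(1) by (simp add: subset_iff)

lemma mem_seq [simp]: "s \<epsilon> seq E x \<longleftrightarrow> (\<exists>n. n \<epsilon> \<omega> \<and> is_fun E s n x)"
proof -
  obtain c where c: "\<And>f d. d \<sqsubseteq> \<omega> \<Longrightarrow> is_fun E f d x \<Longrightarrow> f \<epsilon> c"
    using is_fun_bounded by blast
  show ?thesis
    unfolding seq_def
    by (rule mem_setof_bounded[where x = c], intro definability, use c omega_subset in blast)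
qed

lemma mem_seq_inj [simp]: "s \<epsilon> seq_inj E x \<longleftrightarrow> (\<exists>n. n \<epsilon> \<omega> \<and> is_inj E s n x)"
  unfolding seq_inj_def
  by (rule mem_setof_bounded[where x = "seq E x"], intro definability, use is_injD(1) in auto)

lemma definable_fin [definability]: "DT s \<Longrightarrow> DT (\<lambda>v. fin E (s v))"
  by (rule definable_term_subst1[where F = "fin E"], rule definable_termI, rule mem_fin) (intro definability)

section \<open>Equinumerosity\<close>

lemma equinumerousI:
  assumes "D (\<lambda>v. R (v 0) (v 1))"
    and "\<And>a. a \<epsilon> A \<Longrightarrow> \<exists>b. b \<epsilon> B \<and> R a b"
    and "\<And>b. b \<epsilon> B \<Longrightarrow> \<exists>a. a \<epsilon> A \<and> R a b"
    and "\<And>a b b'. a \<epsilon> A \<Longrightarrow> b \<epsilon> B \<Longrightarrow> b' \<epsilon> B \<Longrightarrow> R a b \<Longrightarrow> R a b' \<Longrightarrow> b = b'"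
    and "\<And>a a' b. a \<epsilon> A \<Longrightarrow> a' \<epsilon> A \<Longrightarrow> b \<epsilon> B \<Longrightarrow> R a b \<Longrightarrow> R a' b \<Longrightarrow> a = a'"
  shows "A \<approx> B"
proof -
  obtain f where f: "p \<epsilon> f \<longleftrightarrow> (\<exists>x y. x \<epsilon> A \<and> y \<epsilon> B \<and> R x y \<and> p = \<langle>x, y\<rangle>)" for p
    using graph_exists[OF assms(1)] by metis
  then have pair: "\<langle>x, y\<rangle> \<epsilon> f \<longleftrightarrow> x \<epsilon> A \<and> y \<epsilon> B \<and> R x y" for x y
    by auto
  have "is_fun E f A B"
  proof (rule is_funI)
    show "\<exists>u w. u \<epsilon> A \<and> w \<epsilon> B \<and> p = \<langle>u, w\<rangle>" if "p \<epsilon> f" for p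
      using that f by blast
    show "\<exists>w. \<langle>u, w\<rangle> \<epsilon> f" if "u \<epsilon> A" for u
      using assms(2)[OF that] that by (auto simp: pair)
    show "w = w'" if "\<langle>u, w\<rangle> \<epsilon> f" "\<langle>u, w'\<rangle> \<epsilon> f" for u w w'
      using that assms(4) by (auto simp: pair)
  qed
  then have "is_bij E f A B"
    unfolding is_bij_def is_inj_def using pair assms(3,5) by blast
  then show ?thesis
    unfolding equinumerous_def by blast
qed

lemma equinumerousE:
  assumes "A \<approx> B"
  obtains f where "is_inj E f A B" "\<And>b. b \<epsilon> B \<Longrightarrow> \<exists>a. \<langle>a, b\<rangle> \<epsilon> f"
  using assms unfolding equinumerous_def is_bij_def by blast

lemma equinumerous_refl: "A \<approx> A"
  by (rule equinumerousI[where R = "(=)"], intro definability) auto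

lemma equinumerous_sym:
  assumes "A \<approx> B"
  shows "B \<approx> A"
proof -
  obtain f where f: "is_inj E f A B" "\<And>b. b \<epsilon> B \<Longrightarrow> \<exists>a. \<langle>a, b\<rangle> \<epsilon> f"
    using equinumerousE[OF assms] by blast
  note fD = is_funD[OF is_injD(1)[OF f(1)]]
  show ?thesis
  proof (rule equinumerousI[where R = "\<lambda>b a. \<langle>a, b\<rangle> \<epsilon> f"], intro definability)
    show "\<exists>a. a \<epsilon> A \<and> \<langle>a, b\<rangle> \<epsilon> f" if "b \<epsilon> B" for b
      using f(2)[OF that] fD(2) by blast
    show "\<exists>b. b \<epsilon> B \<and> \<langle>a, b\<rangle> \<epsilon> f" if "a \<epsilon> A" for a
      using fD(5)[OF that] fD(3) by blast
  qed (use fD(4) is_injD(2)[OF f(1)] in blast)+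
qed

lemma equinumerous_trans:
  assumes "A \<approx> B" "B \<approx> C"
  shows "A \<approx> C"
proof -
  obtain f where f: "is_inj E f A B" "\<And>b. b \<epsilon> B \<Longrightarrow> \<exists>a. \<langle>a, b\<rangle> \<epsilon> f"
    using equinumerousE[OF assms(1)] by blast
  obtain g where g: "is_inj E g B C" "\<And>c. c \<epsilon> C \<Longrightarrow> \<exists>b. \<langle>b, c\<rangle> \<epsilon> g"
    using equinumerousE[OF assms(2)] by blast
  note fD = is_funD[OF is_injD(1)[OF f(1)]] is_injD(2)[OF f(1)]
  note gD = is_funD[OF is_injD(1)[OF g(1)]] is_injD(2)[OF g(1)]
  show ?thesis
  proof (rule equinumerousI[where R = "\<lambda>a c. \<exists>b. \<langle>a, b\<rangle> \<epsilon> f \<and> \<langle>b, c\<rangle> \<epsilon> g"], intro definability)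
    show "\<exists>c. c \<epsilon> C \<and> (\<exists>b. \<langle>a, b\<rangle> \<epsilon> f \<and> \<langle>b, c\<rangle> \<epsilon> g)" if "a \<epsilon> A" for a
      using that fD(3,5) gD(3,5) by meson
    show "\<exists>a. a \<epsilon> A \<and> (\<exists>b. \<langle>a, b\<rangle> \<epsilon> f \<and> \<langle>b, c\<rangle> \<epsilon> g)" if "c \<epsilon> C" for c
      using that f(2) g(2) fD(2) gD(2) by meson
  qed (use fD(4,6) gD(4,6) in metis)+
qed

text \<open>
  The usual proof, with the set on which \<open>F\<close> is used given explicitly as the least set that contains
  \<open>A - G B\<close> and is closed under \<open>G \<circ> F\<close>. This makes the resulting bijection definable, hence an element of
  the model.
\<close>

lemma cantor_bernstein:
  assumes "DT (\<lambda>v. F (v 0))" "DT (\<lambda>v. G (v 0))"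
    and F: "\<And>a. a \<epsilon> A \<Longrightarrow> F a \<epsilon> B" "\<And>a a'. a \<epsilon> A \<Longrightarrow> a' \<epsilon> A \<Longrightarrow> F a = F a' \<Longrightarrow> a = a'"
    and G: "\<And>b. b \<epsilon> B \<Longrightarrow> G b \<epsilon> A" "\<And>b b'. b \<epsilon> B \<Longrightarrow> b' \<epsilon> B \<Longrightarrow> G b = G b' \<Longrightarrow> b = b'"
  shows "A \<approx> B"
proof -
  note [definability] = definable_term_subst1[OF assms(1)] definable_term_subst1[OF assms(2)]
  define closed where "closed Z \<longleftrightarrow> (\<forall>a. a \<epsilon> A \<longrightarrow> (\<forall>b. b \<epsilon> B \<longrightarrow> a \<noteq> G b) \<longrightarrow> a \<epsilon> Z) \<and>
    (\<forall>a. a \<epsilon> A \<longrightarrow> a \<epsilon> Z \<longrightarrow> G (F a) \<epsilon> Z)" for Z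
  have "D (\<lambda>v. \<forall>Z. closed Z \<longrightarrow> v 0 \<epsilon> Z)"
    unfolding closed_def by (intro definability)
  from this obtain d where d: "\<And>z. z \<epsilon> d \<longleftrightarrow> z \<epsilon> A \<and> (\<forall>Z. closed Z \<longrightarrow> z \<epsilon> Z)"
    by (rule separationE[where x = A]) blast
  have d_closed: "closed d"
    using F(1) G(1) unfolding closed_def d by blast
  have "\<exists>a. a \<epsilon> d \<and> b = F a" if b: "b \<epsilon> B" "G b \<epsilon> d" for b
  proof (rule ccontr)
    assume contr: "\<nexists>a. a \<epsilon> d \<and> b = F a"
    have "D (\<lambda>v. v 0 \<noteq> G b)"
      by (intro definability)
    from this obtain Z where Z: "\<And>z. z \<epsilon> Z \<longleftrightarrow> z \<epsilon> d \<and> z \<noteq> G b"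
      by (rule separationE[where x = d]) blast
    \<comment> \<open>\<open>G b\<close> lies in the range of \<open>G\<close> and is not of the form \<open>G (F a)\<close> with \<open>a \<epsilon> d\<close>, so neither
        closure condition puts it into a closed set.\<close>
    have "closed Z"
      using d_closed contr b(1) F(1) G(2) unfolding closed_def Z by metis
    then show False
      using b(2) Z d by blast
  qed
  note d_surj = this
  have "D (\<lambda>v. (v 0 \<epsilon> d \<and> v 1 = F (v 0)) \<or> (\<not> v 0 \<epsilon> d \<and> v 0 = G (v 1)))"
    by (intro definability)
  then show ?thesis
  proof (rule equinumerousI)
    fix a assume "a \<epsilon> A"
    then show "\<exists>b. b \<epsilon> B \<and> (a \<epsilon> d \<and> b = F a \<or> \<not> a \<epsilon> d \<and> a = G b)"
      using d_closed F(1) unfolding closed_def by metis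
  next
    fix b assume "b \<epsilon> B"
    then show "\<exists>a. a \<epsilon> A \<and> (a \<epsilon> d \<and> b = F a \<or> \<not> a \<epsilon> d \<and> a = G b)"
      using d_surj G(1) d by metis
  next
    fix a a' b
    assume "a \<epsilon> A" "a' \<epsilon> A" "b \<epsilon> B" "a \<epsilon> d \<and> b = F a \<or> \<not> a \<epsilon> d \<and> a = G b"
      "a' \<epsilon> d \<and> b = F a' \<or> \<not> a' \<epsilon> d \<and> a' = G b"
    then show "a = a'"
      using d_closed F(2) unfolding closed_def by metis
  qed (use G(2) in metis)
qed

section \<open>Coverings\<close>

text \<open>
  The function may be partial and may take values outside \<open>Y\<close>. This admits the empty set as \<open>Y\<close>, makes
  the notion monotone in both arguments, and spares the choice of default values.
\<close>

definition covers :: "'v \<Rightarrow> 'v \<Rightarrow> bool" where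
  "covers X Y \<longleftrightarrow> (\<exists>f. (\<forall>x y z. \<langle>x, y\<rangle> \<epsilon> f \<longrightarrow> \<langle>x, z\<rangle> \<epsilon> f \<longrightarrow> y = z) \<and>
    (\<forall>y. y \<epsilon> Y \<longrightarrow> (\<exists>x. x \<epsilon> X \<and> \<langle>x, y\<rangle> \<epsilon> f)))"

lemma definable_covers [definability]: "DT s \<Longrightarrow> DT t \<Longrightarrow> D (\<lambda>v. covers (s v) (t v))"
  by (rule definable_subst2[where P = covers], unfold covers_def) (intro definability)

lemma coversI:
  assumes "D (\<lambda>v. R (v 0) (v 1))"
    and "\<And>x y z. x \<epsilon> X \<Longrightarrow> y \<epsilon> Y \<Longrightarrow> z \<epsilon> Y \<Longrightarrow> R x y \<Longrightarrow> R x z \<Longrightarrow> y = z"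
    and "\<And>y. y \<epsilon> Y \<Longrightarrow> \<exists>x. x \<epsilon> X \<and> R x y"
  shows "covers X Y"
proof -
  obtain f where "p \<epsilon> f \<longleftrightarrow> (\<exists>x y. x \<epsilon> X \<and> y \<epsilon> Y \<and> R x y \<and> p = \<langle>x, y\<rangle>)" for p
    using graph_exists[OF assms(1)] by metis
  then have "\<langle>x, y\<rangle> \<epsilon> f \<longleftrightarrow> x \<epsilon> X \<and> y \<epsilon> Y \<and> R x y" for x y
    by auto
  then show ?thesis
    unfolding covers_def using assms(2,3) by (intro exI[of _ f]) blast
qed

lemma coversE:
  assumes "covers X Y"
  obtains f where "\<And>x y z. \<langle>x, y\<rangle> \<epsilon> f \<Longrightarrow> \<langle>x, z\<rangle> \<epsilon> f \<Longrightarrow> y = z"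
    "\<And>y. y \<epsilon> Y \<Longrightarrow> \<exists>x. x \<epsilon> X \<and> \<langle>x, y\<rangle> \<epsilon> f"
  using assms unfolding covers_def by blast

lemma covers_trans:
  assumes "covers X Y" "covers Y Z"
  shows "covers X Z"
proof -
  obtain f where f: "\<And>x y z. \<langle>x, y\<rangle> \<epsilon> f \<Longrightarrow> \<langle>x, z\<rangle> \<epsilon> f \<Longrightarrow> y = z"
    "\<And>y. y \<epsilon> Y \<Longrightarrow> \<exists>x. x \<epsilon> X \<and> \<langle>x, y\<rangle> \<epsilon> f"
    using coversE[OF assms(1)] by blast
  obtain g where g: "\<And>x y z. \<langle>x, y\<rangle> \<epsilon> g \<Longrightarrow> \<langle>x, z\<rangle> \<epsilon> g \<Longrightarrow> y = z"
    "\<And>y. y \<epsilon> Z \<Longrightarrow> \<exists>x. x \<epsilon> Y \<and> \<langle>x, y\<rangle> \<epsilon> g"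
    using coversE[OF assms(2)] by blast
  show ?thesis
  proof (rule coversI[where R = "\<lambda>x z. \<exists>y. \<langle>x, y\<rangle> \<epsilon> f \<and> \<langle>y, z\<rangle> \<epsilon> g"], intro definability)
    show "y = z" if "\<exists>u. \<langle>x, u\<rangle> \<epsilon> f \<and> \<langle>u, y\<rangle> \<epsilon> g" "\<exists>u. \<langle>x, u\<rangle> \<epsilon> f \<and> \<langle>u, z\<rangle> \<epsilon> g" for x y z
      using that f(1) g(1) by metis
    show "\<exists>x. x \<epsilon> X \<and> (\<exists>y. \<langle>x, y\<rangle> \<epsilon> f \<and> \<langle>y, z\<rangle> \<epsilon> g)" if "z \<epsilon> Z" for z
      using that f(2) g(2) by meson
  qed
qed

lemma covers_subset: "Y \<sqsubseteq> X \<Longrightarrow> covers X Y"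
  by (rule coversI[where R = "(=)"], intro definability) (auto simp: subset_iff)

lemma covers_equinumerous:
  assumes "A \<approx> B"
  shows "covers A B"
  using assms is_funD(2,4)[OF is_injD(1)] unfolding covers_def by (meson equinumerousE)

definition preimage :: "'v \<Rightarrow> 'v \<Rightarrow> 'v \<Rightarrow> 'v" where
  "preimage f X Z = setof E (\<lambda>x. x \<epsilon> X \<and> (\<exists>z. z \<epsilon> Z \<and> \<langle>x, z\<rangle> \<epsilon> f))"

lemma mem_preimage: "x \<epsilon> preimage f X Z \<longleftrightarrow> x \<epsilon> X \<and> (\<exists>z. z \<epsilon> Z \<and> \<langle>x, z\<rangle> \<epsilon> f)"
  unfolding preimage_def by (rule mem_setof_bounded[where x = X], intro definability) blast

text \<open>
  The preimage map is injective because a subset \<open>Z\<close> of \<open>Y\<close> is the part in \<open>Y\<close> of the image of its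
  preimage. The embedding is given as a definable operation, in the form that
  \<open>cantor_bernstein\<close> takes.
\<close>

lemma pow_embedding:
  assumes "covers X Y"
  obtains F where "DT (\<lambda>v. F (v 0))" "\<And>Z. Z \<epsilon> pow E Y \<Longrightarrow> F Z \<epsilon> pow E X"
    "\<And>Z Z'. Z \<epsilon> pow E Y \<Longrightarrow> Z' \<epsilon> pow E Y \<Longrightarrow> F Z = F Z' \<Longrightarrow> Z = Z'"
proof -
  obtain f where f: "\<And>x y z. \<langle>x, y\<rangle> \<epsilon> f \<Longrightarrow> \<langle>x, z\<rangle> \<epsilon> f \<Longrightarrow> y = z"
    "\<And>y. y \<epsilon> Y \<Longrightarrow> \<exists>x. x \<epsilon> X \<and> \<langle>x, y\<rangle> \<epsilon> f"
    using coversE[OF assms] by blast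
  have recover: "y \<epsilon> Z \<longleftrightarrow> y \<epsilon> Y \<and> (\<exists>x. x \<epsilon> preimage f X Z \<and> \<langle>x, y\<rangle> \<epsilon> f)" if "Z \<sqsubseteq> Y" for Z y
    using that f unfolding mem_preimage subset_iff by metis
  show ?thesis
  proof (rule that[of "preimage f X"])
    show "DT (\<lambda>v. preimage f X (v 0))"
      by (rule definable_termI, rule mem_preimage) (intro definability)
    show "Z = Z'" if "Z \<epsilon> pow E Y" "Z' \<epsilon> pow E Y" "preimage f X Z = preimage f X Z'" for Z Z'
      using that recover by (intro set_eqI) simp
  qed (simp add: subset_iff mem_preimage)
qed

lemma pow_equinumerous:
  assumes "covers X Y" "covers Y X"
  shows "pow E X \<approx> pow E Y"
proof -
  obtain F where F: "DT (\<lambda>v. F (v 0))" "\<And>Z. Z \<epsilon> pow E X \<Longrightarrow> F Z \<epsilon> pow E Y"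
    "\<And>Z Z'. Z \<epsilon> pow E X \<Longrightarrow> Z' \<epsilon> pow E X \<Longrightarrow> F Z = F Z' \<Longrightarrow> Z = Z'"
    using pow_embedding[OF assms(2)] by blast
  obtain G where G: "DT (\<lambda>v. G (v 0))" "\<And>Z. Z \<epsilon> pow E Y \<Longrightarrow> G Z \<epsilon> pow E X"
    "\<And>Z Z'. Z \<epsilon> pow E Y \<Longrightarrow> Z' \<epsilon> pow E Y \<Longrightarrow> G Z = G Z' \<Longrightarrow> Z = Z'"
    using pow_embedding[OF assms(1)] by blast
  show ?thesis
    by (rule cantor_bernstein[where F = F and G = G]) (fact F G)+
qed

section \<open>Finite sets\<close>

lemma finite_empty [simp]: "is_finite E \<emptyset>"
  unfolding is_finite_def using zero_omega equinumerous_refl by blast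

lemma finite_omega: "n \<epsilon> \<omega> \<Longrightarrow> is_finite E n"
  unfolding is_finite_def using equinumerous_refl by blast

lemma finite_adjoin [simp]:
  assumes "is_finite E A"
  shows "is_finite E (adjoin a A)"
proof (cases "a \<epsilon> A")
  case True
  then have "adjoin a A = A"
    by (auto intro: set_eqI)
  then show ?thesis
    using assms by simp
next
  case False
  obtain n where n: "n \<epsilon> \<omega>" "A \<approx> n"
    using assms unfolding is_finite_def by blast
  obtain f where f: "is_inj E f A n" "\<And>b. b \<epsilon> n \<Longrightarrow> \<exists>a. \<langle>a, b\<rangle> \<epsilon> f"
    using equinumerousE[OF n(2)] by blast
  note fD = is_funD(2-)[OF is_injD(1)[OF f(1)]] is_injD(2)[OF f(1)]
  have "adjoin a A \<approx> succ E n"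
  proof (rule equinumerousI[where R = "\<lambda>x y. \<langle>x, y\<rangle> \<epsilon> f \<or> x = a \<and> y = n"], intro definability)
    show "\<exists>b. b \<epsilon> succ E n \<and> (\<langle>x, b\<rangle> \<epsilon> f \<or> x = a \<and> b = n)" if "x \<epsilon> adjoin a A" for x
      using that fD(2,4) unfolding mem_adjoin mem_succ by metis
    show "\<exists>x. x \<epsilon> adjoin a A \<and> (\<langle>x, b\<rangle> \<epsilon> f \<or> x = a \<and> b = n)" if "b \<epsilon> succ E n" for b
      using that fD(1) f(2) unfolding mem_adjoin mem_succ by metis
  qed (use fD False mem_irrefl in metis)+
  then show ?thesis
    unfolding is_finite_def using n(1) succ_omega by blast
qed

text \<open>
  Induction over the number of elements: a set equinumerous to \<open>n + 1\<close> arises by adjoining the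
  element that the bijection sends to \<open>n\<close> to a set equinumerous to \<open>n\<close>.
\<close>

lemma finite_set_induct [consumes 1, case_names definable empty adjoin]:
  assumes "is_finite E A" "D (\<lambda>v. P (v 0))" "P \<emptyset>"
    and "\<And>a A. is_finite E A \<Longrightarrow> \<not> a \<epsilon> A \<Longrightarrow> P A \<Longrightarrow> P (adjoin a A)"
  shows "P A"
proof -
  note [definability] = definable_subst1[OF assms(2)]
  have "\<forall>A. A \<approx> n \<longrightarrow> P A" if "n \<epsilon> \<omega>" for n
    using that
  proof (induction rule: omega_induct)
    case definable
    show ?case
      by (intro definability)
  next
    case zero
    have "A = \<emptyset>" if "A \<approx> \<emptyset>" for A
      using equinumerousE[OF that] is_funD(3,5)[OF is_injD(1)] mem_zero by (metis set_eqI)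
    then show ?case
      using assms(3) by blast
  next
    case (succ n)
    show ?case
    proof (intro allI impI)
      fix A assume "A \<approx> succ E n"
      then obtain f where f: "is_inj E f A (succ E n)" "\<And>b. b \<epsilon> succ E n \<Longrightarrow> \<exists>a. \<langle>a, b\<rangle> \<epsilon> f"
        using equinumerousE by blast
      note fD = is_funD(2-)[OF is_injD(1)[OF f(1)]] is_injD(2)[OF f(1)]
      obtain a where a: "\<langle>a, n\<rangle> \<epsilon> f"
        using f(2) mem_succ by blast
      have "D (\<lambda>v. v 0 \<noteq> a)"
        by (intro definability)
      from this obtain A' where A': "\<And>z. z \<epsilon> A' \<longleftrightarrow> z \<epsilon> A \<and> z \<noteq> a"
        by (rule separationE[where x = A]) blast
      have A: "A = adjoin a A'"
        using fD(1)[OF a] by (intro set_eqI) (auto simp: A')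
      have "A' \<approx> n"
      proof (rule equinumerousI[where R = "\<lambda>x y. \<langle>x, y\<rangle> \<epsilon> f"], intro definability)
        show "\<exists>b. b \<epsilon> n \<and> \<langle>x, b\<rangle> \<epsilon> f" if "x \<epsilon> A'" for x
          using that A' a fD mem_succ by metis
        show "\<exists>x. x \<epsilon> A' \<and> \<langle>x, b\<rangle> \<epsilon> f" if "b \<epsilon> n" for b
          using that A' a fD f(2) mem_succ mem_irrefl by metis
      qed (use fD in blast)+
      moreover from this have "is_finite E A'"
        unfolding is_finite_def using succ.hyps by blast
      ultimately show "P A"
        unfolding A using succ assms(4) A' by blast
    qed
  qed
  then show ?thesis
    using assms(1) unfolding is_finite_def by blast
qed

text \<open>
  The source of all finiteness statements about images of finite sets below.
\<close>

lemma finite_covers: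
  assumes "is_finite E A" "covers A B"
  shows "is_finite E B"
proof -
  have "\<forall>B. covers A B \<longrightarrow> is_finite E B"
    using assms(1)
  proof (induction rule: finite_set_induct)
    case definable
    show ?case
      by (intro definability)
  next
    case empty
    have "B = \<emptyset>" if "covers \<emptyset> B" for B
      using coversE[OF that] mem_zero by (metis set_eqI)
    then show ?case
      using finite_empty by blast
  next
    case (adjoin a A)
    show ?case
    proof (intro allI impI)
      fix B assume "covers (adjoin a A) B"
      then obtain f where f: "\<And>x y z. \<langle>x, y\<rangle> \<epsilon> f \<Longrightarrow> \<langle>x, z\<rangle> \<epsilon> f \<Longrightarrow> y = z"
        "\<And>y. y \<epsilon> B \<Longrightarrow> \<exists>x. x \<epsilon> adjoin a A \<and> \<langle>x, y\<rangle> \<epsilon> f"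
        using coversE by blast
      have "D (\<lambda>v. \<not> \<langle>a, v 0\<rangle> \<epsilon> f)"
        by (intro definability)
      from this obtain B' where B': "\<And>z. z \<epsilon> B' \<longleftrightarrow> z \<epsilon> B \<and> \<not> \<langle>a, z\<rangle> \<epsilon> f"
        by (rule separationE[where x = B]) blast
      have "covers A B'"
        unfolding covers_def using f B' mem_adjoin by (intro exI[of _ f]) metis
      then have fin: "is_finite E B'"
        using adjoin by blast
      show "is_finite E B"
      proof (cases "\<exists>b. b \<epsilon> B \<and> \<langle>a, b\<rangle> \<epsilon> f")
        case True
        then obtain b where "b \<epsilon> B" "\<langle>a, b\<rangle> \<epsilon> f"
          by blast
        then have "B = adjoin b B'"
          using f(1) B' by (intro set_eqI) auto
        then show ?thesis
          using fin by simp
      next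
        case False
        then have "B = B'"
          using B' by (intro set_eqI) blast
        then show ?thesis
          using fin by simp
      qed
    qed
  qed
  then show ?thesis
    using assms(2) by blast
qed

lemma finite_bin_union:
  assumes "is_finite E A" "is_finite E B"
  shows "is_finite E (bin_union A B)"
  using assms(1)
proof (induction rule: finite_set_induct)
  case definable
  show ?case
    by (intro definability)
next
  case empty
  have "bin_union \<emptyset> B = B"
    by (intro set_eqI) simp
  then show ?case
    using assms(2) by simp
next
  case (adjoin a A)
  have "bin_union (adjoin a A) B = adjoin a (bin_union A B)"
    by (intro set_eqI) auto
  then show ?case
    using adjoin by simp
qed

lemma finite_big_union:
  assumes "is_finite E Q" "\<And>t. t \<epsilon> Q \<Longrightarrow> is_finite E t"
  shows "is_finite E (big_union Q)"
proof -
  have "(\<forall>t. t \<epsilon> Q \<longrightarrow> is_finite E t) \<longrightarrow> is_finite E (big_union Q)"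
    using assms(1)
  proof (induction rule: finite_set_induct)
    case definable
    show ?case
      by (intro definability)
  next
    case empty
    have "big_union \<emptyset> = \<emptyset>"
      by (intro set_eqI) simp
    then show ?case
      by simp
  next
    case (adjoin a A)
    have "big_union (adjoin a A) = bin_union a (big_union A)"
      by (intro set_eqI) auto
    then show ?case
      using adjoin finite_bin_union by simp
  qed
  then show ?thesis
    using assms(2) by blast
qed

lemma finite_upair [simp]: "is_finite E (upair E a b)"
proof -
  have "upair E a b = adjoin a (adjoin b \<emptyset>)"
    by (intro set_eqI) auto
  then show ?thesis
    by simp
qed

text \<open>
  Finite sets are mapped to their images. Surjectivity amounts to finding preimages for finitely many
  points, a finite choice that is made by induction.
\<close>

lemma covers_fin:
  assumes "covers X Y"
  shows "covers (fin E X) (fin E Y)"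
proof -
  obtain f where f: "\<And>x y z. \<langle>x, y\<rangle> \<epsilon> f \<Longrightarrow> \<langle>x, z\<rangle> \<epsilon> f \<Longrightarrow> y = z"
    "\<And>y. y \<epsilon> Y \<Longrightarrow> \<exists>x. x \<epsilon> X \<and> \<langle>x, y\<rangle> \<epsilon> f"
    using coversE[OF assms] by blast
  have "B \<sqsubseteq> Y \<longrightarrow> (\<exists>A. A \<epsilon> fin E X \<and> B = rel_image f A)" if "is_finite E B" for B
    using that
  proof (induction rule: finite_set_induct)
    case definable
    show ?case
      by (intro definability)
  next
    case empty
    have "\<emptyset> \<epsilon> fin E X" "\<emptyset> = rel_image f \<emptyset>"
      by (auto simp: subset_iff intro: set_eqI)
    then show ?case
      by blast
  next
    case (adjoin b B)
    show ?case
    proof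
      assume sub: "adjoin b B \<sqsubseteq> Y"
      then obtain A where A: "A \<sqsubseteq> X" "is_finite E A" "B = rel_image f A"
        using adjoin by (auto simp: subset_iff)
      obtain a where a: "a \<epsilon> X" "\<langle>a, b\<rangle> \<epsilon> f"
        using sub f(2) by (auto simp: subset_iff)
      have "adjoin b B = rel_image f (adjoin a A)"
        using a f(1) by (intro set_eqI) (auto simp: A(3))
      moreover have "adjoin a A \<epsilon> fin E X"
        using A a by (auto simp: subset_iff)
      ultimately show "\<exists>A. A \<epsilon> fin E X \<and> adjoin b B = rel_image f A"
        by blast
    qed
  qed
  then show ?thesis
    by (intro coversI[where R = "\<lambda>A B. B = rel_image f A"], intro definability) auto
qed

lemma covers_fin_self: "covers (fin E Z) Z"
proof (rule coversI[where R = "\<lambda>A z. A = upair E z z"], intro definability)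
  show "\<exists>A. A \<epsilon> fin E Z \<and> A = upair E z z" if "z \<epsilon> Z" for z
    using that by (simp add: subset_iff)
qed (auto simp: upair_eq_iff)

section \<open>Recursion\<close>

text \<open>
  \<open>iterate H a n y\<close> says that \<open>y\<close> is the result of applying \<open>H\<close> to \<open>a\<close> \<open>n\<close> times, for \<open>n\<close> in the model's
  \<open>\<omega>\<close>. The formula has the shape of the one in the definition of \<open>fin_iter\<close>, so that
  \<open>fin_iter m x\<close> is an instance.
\<close>

definition iterate :: "('v \<Rightarrow> 'v) \<Rightarrow> 'v \<Rightarrow> 'v \<Rightarrow> 'v \<Rightarrow> bool" where
  "iterate H a n y \<longleftrightarrow> (\<exists>g c. is_fun E g (succ E n) c \<and> \<langle>\<emptyset>, a\<rangle> \<epsilon> g \<and>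
     (\<forall>k z. k \<epsilon> n \<longrightarrow> \<langle>k, z\<rangle> \<epsilon> g \<longrightarrow> \<langle>succ E k, H z\<rangle> \<epsilon> g) \<and> \<langle>n, y\<rangle> \<epsilon> g)"

lemma definable_iterate:
  assumes "DT (\<lambda>v. H (v 0))" "DT s" "DT t" "DT u"
  shows "D (\<lambda>v. iterate H (s v) (t v) (u v))"
  by (rule definable_subst3[OF _ assms(2-4)], unfold iterate_def)
    (intro definability definable_term_subst1[OF assms(1)])

lemma succ_mem_succD: "n \<epsilon> \<omega> \<Longrightarrow> succ E k \<epsilon> succ E n \<Longrightarrow> k \<epsilon> n"
  using omega_mem_trans[of n "succ E k" k] by (metis mem_succ)

lemma iterate_unique:
  assumes "DT (\<lambda>v. H (v 0))" "n \<epsilon> \<omega>" "iterate H a n y" "iterate H a n y'"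
  shows "y = y'"
proof -
  obtain g c where g: "is_fun E g (succ E n) c" "\<langle>\<emptyset>, a\<rangle> \<epsilon> g" "\<langle>n, y\<rangle> \<epsilon> g"
    and g_step: "\<And>k z. k \<epsilon> n \<Longrightarrow> \<langle>k, z\<rangle> \<epsilon> g \<Longrightarrow> \<langle>succ E k, H z\<rangle> \<epsilon> g"
    using assms(3) unfolding iterate_def by blast
  obtain h d where h: "is_fun E h (succ E n) d" "\<langle>\<emptyset>, a\<rangle> \<epsilon> h" "\<langle>n, y'\<rangle> \<epsilon> h"
    and h_step: "\<And>k z. k \<epsilon> n \<Longrightarrow> \<langle>k, z\<rangle> \<epsilon> h \<Longrightarrow> \<langle>succ E k, H z\<rangle> \<epsilon> h"
    using assms(4) unfolding iterate_def by blast
  note gD = is_funD(4,5)[OF g(1)] and hD = is_funD(4,5)[OF h(1)]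
  have "k \<epsilon> succ E n \<longrightarrow> (\<forall>z z'. \<langle>k, z\<rangle> \<epsilon> g \<longrightarrow> \<langle>k, z'\<rangle> \<epsilon> h \<longrightarrow> z = z')" if "k \<epsilon> \<omega>" for k
    using that
  proof (induction rule: omega_induct)
    case definable
    show ?case
      by (intro definability)
  next
    case zero
    show ?case
      using g(2) h(2) gD(1) hD(1) by blast
  next
    case (succ k)
    show ?case
    proof (intro impI allI)
      fix z z' assume k: "succ E k \<epsilon> succ E n" and z: "\<langle>succ E k, z\<rangle> \<epsilon> g" "\<langle>succ E k, z'\<rangle> \<epsilon> h"
      have kn: "k \<epsilon> n"
        using succ_mem_succD[OF assms(2) k] .
      then obtain u where "\<langle>k, u\<rangle> \<epsilon> g" "\<langle>k, u\<rangle> \<epsilon> h"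
        using gD(2) hD(2) succ.IH mem_succ by metis
      then show "z = z'"
        using g_step[OF kn] h_step[OF kn] z gD(1) hD(1) by metis
    qed
  qed
  then show ?thesis
    using g(3) h(3) assms(2) by simp
qed

lemma iterate_zero: "iterate H a \<emptyset> a"
proof -
  define g where "g = upair E \<langle>\<emptyset>, a\<rangle> \<langle>\<emptyset>, a\<rangle>"
  have "is_fun E g (succ E \<emptyset>) (upair E a a)"
    by (rule is_funI) (auto simp: g_def)
  then show ?thesis
    unfolding iterate_def by (intro exI[of _ g] exI[of _ "upair E a a"]) (auto simp: g_def)
qed

lemma iterate_succ:
  assumes "n \<epsilon> \<omega>" "iterate H a n y"
  shows "iterate H a (succ E n) (H y)"
proof -
  obtain g c where g: "is_fun E g (succ E n) c" "\<langle>\<emptyset>, a\<rangle> \<epsilon> g" "\<langle>n, y\<rangle> \<epsilon> g"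
    and g_step: "\<And>k z. k \<epsilon> n \<Longrightarrow> \<langle>k, z\<rangle> \<epsilon> g \<Longrightarrow> \<langle>succ E k, H z\<rangle> \<epsilon> g"
    using assms(2) unfolding iterate_def by blast
  note gD = is_funD[OF g(1)]
  define h where "h = adjoin \<langle>succ E n, H y\<rangle> g"
  have pair: "\<langle>u, w\<rangle> \<epsilon> h \<longleftrightarrow> \<langle>u, w\<rangle> \<epsilon> g \<or> u = succ E n \<and> w = H y" for u w
    by (simp add: h_def)
  have new: "\<not> \<langle>succ E n, w\<rangle> \<epsilon> g" for w
    using gD(2) mem_irrefl by blast
  have "is_fun E h (succ E (succ E n)) (adjoin (H y) c)"
  proof (rule is_funI)
    show "\<exists>u w. u \<epsilon> succ E (succ E n) \<and> w \<epsilon> adjoin (H y) c \<and> p = \<langle>u, w\<rangle>" if "p \<epsilon> h" for p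
      using that gD(1)[of p] unfolding h_def mem_adjoin mem_succ by blast
    show "\<exists>w. \<langle>u, w\<rangle> \<epsilon> h" if "u \<epsilon> succ E (succ E n)" for u
      using that gD(5) unfolding pair mem_succ by blast
    show "w = w'" if "\<langle>u, w\<rangle> \<epsilon> h" "\<langle>u, w'\<rangle> \<epsilon> h" for u w w'
      using that new gD(4) unfolding pair by blast
  qed
  moreover have "\<langle>succ E k, H z\<rangle> \<epsilon> h" if k: "k \<epsilon> succ E n" and z: "\<langle>k, z\<rangle> \<epsilon> h" for k z
  proof -
    have kz: "\<langle>k, z\<rangle> \<epsilon> g"
      using k z mem_irrefl unfolding pair by blast
    show ?thesis
    proof (cases "k = n")
      case True
      then have "z = y"
        using kz g(3) gD(4) by blast
      then show ?thesis
        using True pair by blast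
    next
      case False
      then show ?thesis
        using k kz g_step pair by simp
    qed
  qed
  ultimately show ?thesis
    unfolding iterate_def using g(2) pair by blast
qed

lemma iterate_exists:
  assumes "DT (\<lambda>v. H (v 0))" "n \<epsilon> \<omega>"
  shows "\<exists>y. iterate H a n y"
  using assms(2)
proof (induction rule: omega_induct)
  case definable
  show ?case
    by (intro definability definable_iterate[OF assms(1)])
qed (use iterate_zero iterate_succ in blast)+

section \<open>Binary counting\<close>

text \<open>
  If a set of natural numbers is read as a binary numeral, then \<open>increment\<close> adds one: the digit at
  position \<open>z\<close> flips if and only if all lower digits are set, and \<open>z \<sqsubseteq> A\<close> says just this, since \<open>z\<close> is the
  set of all smaller numbers.
\<close>

definition increment :: "'v \<Rightarrow> 'v" where
  "increment A = setof E (\<lambda>z. z \<epsilon> \<omega> \<and> (z \<epsilon> A \<longleftrightarrow> \<not> z \<sqsubseteq> A))"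

lemma mem_increment [simp]: "z \<epsilon> increment A \<longleftrightarrow> z \<epsilon> \<omega> \<and> (z \<epsilon> A \<longleftrightarrow> \<not> z \<sqsubseteq> A)"
  unfolding increment_def by (rule mem_setof_bounded[where x = \<omega>], intro definability) blast

lemma definable_increment: "DT (\<lambda>v. increment (v 0))"
  by (rule definable_termI, rule mem_increment) (intro definability)

abbreviation "counts n A \<equiv> iterate increment \<emptyset> n A"

lemmas definable_counts [definability] = definable_iterate[OF definable_increment]

text \<open>
  The numeral \<open>n\<close> has no digits at positions \<open>n\<close> or above: a digit newly set at position \<open>z\<close> requires
  that all positions below \<open>z\<close>, being set in the previous numeral, lie below its bound.
\<close>

lemma counts_bounded:
  assumes "n \<epsilon> \<omega>" "counts n A"
  shows "A \<sqsubseteq> n"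
proof -
  have "\<forall>A. counts n A \<longrightarrow> A \<sqsubseteq> n"
    using assms(1)
  proof (induction rule: omega_induct)
    case definable
    show ?case
      by (intro definability)
  next
    case zero
    have "A = \<emptyset>" if "counts \<emptyset> A" for A
      using iterate_unique[OF definable_increment zero_omega that iterate_zero] .
    then show ?case
      using subset_refl by blast
  next
    case (succ n)
    show ?case
    proof (intro allI impI)
      fix B assume B: "counts (succ E n) B"
      obtain A where A: "counts n A"
        using iterate_exists[OF definable_increment succ.hyps] by blast
      have B_eq: "B = increment A"
        using iterate_unique[OF definable_increment _ B iterate_succ[OF succ.hyps A]] succ.hyps
        by simp
      have sub: "A \<sqsubseteq> n"
        using succ.IH A by blast
      show "B \<sqsubseteq> succ E n"
        unfolding subset_iff
      proof (intro allI impI)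
        fix z assume "z \<epsilon> B"
        then have z: "z \<epsilon> \<omega>" "z \<epsilon> A \<or> z \<sqsubseteq> A"
          by (auto simp: B_eq)
        then have "\<not> n \<epsilon> z"
          using sub mem_irrefl mem_asym unfolding subset_iff by metis
        then show "z \<epsilon> succ E n"
          using omega_linear[OF succ.hyps z(1)] by auto
      qed
    qed
  qed
  then show ?thesis
    using assms(2) by blast
qed

text \<open>
  Carrying: adding one to a numeral whose last \<open>k\<close> digits are ones, with a zero in front of them, clears
  these digits and sets the digit at \<open>k\<close>.
\<close>

lemma increment_carry:
  assumes "k \<epsilon> \<omega>" "A \<sqsubseteq> \<omega>" "\<And>z. z \<epsilon> succ E k \<Longrightarrow> \<not> z \<epsilon> A"
  shows "increment (bin_union A k) = adjoin k A"
proof (rule set_eqI)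
  fix z
  show "z \<epsilon> increment (bin_union A k) \<longleftrightarrow> z \<epsilon> adjoin k A"
  proof (cases "z \<epsilon> \<omega>")
    case True
    consider "z \<epsilon> k" | "z = k" | "k \<epsilon> z"
      using omega_linear[OF assms(1) True] by blast
    then show ?thesis
    proof cases
      case 1
      then have "z \<sqsubseteq> bin_union A k" "\<not> z \<epsilon> A" "z \<noteq> k"
        using omega_trans(2)[OF assms(1)] assms(3) by (auto simp: subset_iff)
      then show ?thesis
        using 1 by simp
    next
      case 2
      then show ?thesis
        using assms by (simp add: subset_iff)
    next
      case 3
      then have "\<not> z \<sqsubseteq> bin_union A k" "\<not> z \<epsilon> k" "z \<noteq> k"
        using assms(3)[of k] mem_asym by (auto simp: subset_iff)
      then show ?thesis
        using True by simp
    qed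
  next
    case False
    then show ?thesis
      using assms(1,2) by (auto simp: subset_iff)
  qed
qed

text \<open>
  Counting on from a numeral that ends in \<open>k\<close> zeros passes through all ways of filling these last \<open>k\<close>
  digits. To fill \<open>k + 1\<close> digits with a one in the leading position, count until the lower \<open>k\<close>
  digits are all ones, add one, and fill the lower digits once more. The starting numeral is quantified
  inside, since the second filling starts from a different one.
\<close>

lemma counts_reach:
  assumes "k \<epsilon> \<omega>"
  shows "\<forall>n A B. n \<epsilon> \<omega> \<longrightarrow> counts n A \<longrightarrow> A \<sqsubseteq> \<omega> \<longrightarrow> (\<forall>z. z \<epsilon> k \<longrightarrow> \<not> z \<epsilon> A) \<longrightarrow> B \<sqsubseteq> k \<longrightarrow>
    (\<exists>n'. n' \<epsilon> \<omega> \<and> counts n' (bin_union A B))"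
  using assms
proof (induction rule: omega_induct)
  case definable
  show ?case
    by (intro definability)
next
  case zero
  have "bin_union A B = A" if "B \<sqsubseteq> \<emptyset>" for A B
    using that by (intro set_eqI) (simp add: subset_iff)
  then show ?case
    by metis
next
  case (succ k)
  show ?case
  proof (intro allI impI)
    fix n A B
    assume n: "n \<epsilon> \<omega>" "counts n A" and A: "A \<sqsubseteq> \<omega>" "\<forall>z. z \<epsilon> succ E k \<longrightarrow> \<not> z \<epsilon> A"
      and B: "B \<sqsubseteq> succ E k"
    have low: "\<forall>z. z \<epsilon> k \<longrightarrow> \<not> z \<epsilon> A"
      using A(2) by simp
    show "\<exists>n'. n' \<epsilon> \<omega> \<and> counts n' (bin_union A B)"
    proof (cases "k \<epsilon> B")
      case False
      then have "B \<sqsubseteq> k"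
        using B by (auto simp: subset_iff)
      then show ?thesis
        using succ.IH n A(1) low by blast
    next
      case True
      obtain m where m: "m \<epsilon> \<omega>" "counts m (bin_union A k)"
        using succ.IH n A(1) low subset_refl by blast
      have "D (\<lambda>v. v 0 \<noteq> k)"
        by (intro definability)
      from this obtain B' where B': "\<And>z. z \<epsilon> B' \<longleftrightarrow> z \<epsilon> B \<and> z \<noteq> k"
        by (rule separationE[where x = B]) blast
      have "counts (succ E m) (adjoin k A)"
        using iterate_succ[OF m] increment_carry[OF succ.hyps A(1)] A(2) by simp
      moreover have "adjoin k A \<sqsubseteq> \<omega>" "\<forall>z. z \<epsilon> k \<longrightarrow> \<not> z \<epsilon> adjoin k A"
        using A succ.hyps by (auto simp: subset_iff)
      moreover have "B' \<sqsubseteq> k"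
        using B by (auto simp: subset_iff B')
      ultimately obtain n' where n': "n' \<epsilon> \<omega>" "counts n' (bin_union (adjoin k A) B')"
        using succ.IH succ_omega[OF m(1)] by blast
      have "bin_union (adjoin k A) B' = bin_union A B"
        using True by (intro set_eqI) (auto simp: B')
      then show ?thesis
        using n' by metis
    qed
  qed
qed

lemma finite_bounded:
  assumes "is_finite E A"
  shows "A \<sqsubseteq> \<omega> \<longrightarrow> (\<exists>k. k \<epsilon> \<omega> \<and> A \<sqsubseteq> k)"
  using assms
proof (induction rule: finite_set_induct)
  case definable
  show ?case
    by (intro definability)
next
  case empty
  show ?case
    using zero_omega subset_refl by blast
next
  case (adjoin a A)
  show ?case
  proof
    assume sub: "adjoin a A \<sqsubseteq> \<omega>"
    then obtain k where k: "k \<epsilon> \<omega>" "A \<sqsubseteq> k" and a: "a \<epsilon> \<omega>"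
      using adjoin by (auto simp: subset_iff)
    have "k \<epsilon> succ E a \<or> k = succ E a \<or> succ E a \<epsilon> k"
      using omega_linear[of "succ E a" k] a k(1) by simp
    then consider "k \<sqsubseteq> succ E a" | "succ E a \<sqsubseteq> k"
      using omega_trans(2) a k(1) succ_omega subset_iff by metis
    then show "\<exists>k. k \<epsilon> \<omega> \<and> adjoin a A \<sqsubseteq> k"
    proof cases
      case 1
      then show ?thesis
        using k a by (intro exI[of _ "succ E a"]) (auto simp: subset_iff)
    next
      case 2
      then show ?thesis
        using k a by (intro exI[of _ k]) (auto simp: subset_iff)
    qed
  qed
qed

lemma counts_surj:
  assumes "A \<epsilon> fin E \<omega>"
  shows "\<exists>n. n \<epsilon> \<omega> \<and> counts n A"
proof -
  obtain k where k: "k \<epsilon> \<omega>" "A \<sqsubseteq> k"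
    using assms finite_bounded by auto
  have "\<exists>n. n \<epsilon> \<omega> \<and> counts n (bin_union \<emptyset> A)"
    using counts_reach[OF k(1)] k(2) zero_omega iterate_zero[of increment] mem_zero subset_iff
    by metis
  moreover have "bin_union \<emptyset> A = A"
    by (intro set_eqI) simp
  ultimately show ?thesis
    by simp
qed

lemma omega_covers_fin_omega: "covers \<omega> (fin E \<omega>)"
proof (rule coversI[where R = counts], intro definability)
  show "A = B" if "n \<epsilon> \<omega>" "counts n A" "counts n B" for n A B
    using iterate_unique[OF definable_increment that] .
qed (rule counts_surj)

lemma omega_covers_fin: "covers \<omega> Z \<Longrightarrow> covers \<omega> (fin E Z)"
  using covers_trans[OF omega_covers_fin_omega covers_fin] .

definition covers_cofinally :: "'v \<Rightarrow> bool" where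
  "covers_cofinally Y \<longleftrightarrow> (\<exists>e. (\<forall>x y z. \<langle>x, y\<rangle> \<epsilon> e \<longrightarrow> \<langle>x, z\<rangle> \<epsilon> e \<longrightarrow> y = z) \<and>
    (\<forall>y k. y \<epsilon> Y \<longrightarrow> k \<epsilon> \<omega> \<longrightarrow> (\<exists>n. n \<epsilon> \<omega> \<and> k \<epsilon> n \<and> \<langle>n, y\<rangle> \<epsilon> e)))"

text \<open>
  A value \<open>f j\<close> is assigned to \<open>n\<close> when \<open>j\<close> is the least element of the \<open>n\<close>-th finite set of the binary
  count. To attain \<open>f j\<close> beyond a given \<open>k\<close>, take the index \<open>n\<close> of a set \<open>{j, l}\<close> with
  \<open>l \<ge> j\<close> and \<open>l \<ge> k\<close>: since this set is a subset of \<open>n\<close>, it follows that \<open>k \<le> l < n\<close>.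
\<close>

lemma covers_cofinallyI:
  assumes "covers \<omega> Y"
  shows "covers_cofinally Y"
proof -
  obtain f where f: "\<And>x y z. \<langle>x, y\<rangle> \<epsilon> f \<Longrightarrow> \<langle>x, z\<rangle> \<epsilon> f \<Longrightarrow> y = z"
    "\<And>y. y \<epsilon> Y \<Longrightarrow> \<exists>x. x \<epsilon> \<omega> \<and> \<langle>x, y\<rangle> \<epsilon> f"
    using coversE[OF assms] by blast
  define R where "R n y \<longleftrightarrow> (\<exists>A j. counts n A \<and> j \<epsilon> A \<and> (\<forall>i. i \<epsilon> A \<longrightarrow> \<not> i \<epsilon> j) \<and> \<langle>j, y\<rangle> \<epsilon> f)" for n y
  have "D (\<lambda>v. R (v 0) (v 1))"
    unfolding R_def by (intro definability)
  from graph_exists[OF this, of \<omega> Y] obtain e where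
    e: "\<And>p. p \<epsilon> e \<longleftrightarrow> (\<exists>x y. x \<epsilon> \<omega> \<and> y \<epsilon> Y \<and> R x y \<and> p = \<langle>x, y\<rangle>)"
    by blast
  have pair: "\<langle>n, y\<rangle> \<epsilon> e \<longleftrightarrow> n \<epsilon> \<omega> \<and> y \<epsilon> Y \<and> R n y" for n y
    by (auto simp: e)
  have "y = z" if n: "n \<epsilon> \<omega>" and Ry: "R n y" and Rz: "R n z" for n y z
  proof -
    obtain A j where A: "counts n A" "j \<epsilon> A" "\<forall>i. i \<epsilon> A \<longrightarrow> \<not> i \<epsilon> j" "\<langle>j, y\<rangle> \<epsilon> f"
      using Ry unfolding R_def by blast
    obtain j' where j': "j' \<epsilon> A" "\<forall>i. i \<epsilon> A \<longrightarrow> \<not> i \<epsilon> j'" "\<langle>j', z\<rangle> \<epsilon> f"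
      using Rz iterate_unique[OF definable_increment n A(1)] unfolding R_def by blast
    have "j \<epsilon> \<omega>" "j' \<epsilon> \<omega>"
      using counts_bounded[OF n A(1)] A(2) j'(1) omega_trans(1)[OF n]
      by (auto simp: subset_iff)
    then have "j = j'"
      using omega_linear A(2,3) j'(1,2) by blast
    then show ?thesis
      using f(1) A(4) j'(3) by blast
  qed
  moreover have "\<exists>n. n \<epsilon> \<omega> \<and> k \<epsilon> n \<and> R n y" if y: "y \<epsilon> Y" and k: "k \<epsilon> \<omega>" for y k
  proof -
    obtain j where j: "j \<epsilon> \<omega>" "\<langle>j, y\<rangle> \<epsilon> f"
      using f(2)[OF y] by blast
    \<comment> \<open>the maximum of \<open>j\<close> and \<open>k\<close>\<close>
    define l where "l = (if j \<epsilon> k then k else j)"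
    have l: "l \<epsilon> \<omega>" "\<not> l \<epsilon> j" "k = l \<or> k \<epsilon> l"
      using j(1) k omega_linear[OF k j(1)] mem_asym unfolding l_def by auto
    have "upair E j l \<epsilon> fin E \<omega>"
      using j(1) l(1) by (auto simp: subset_iff)
    then obtain n where n: "n \<epsilon> \<omega>" "counts n (upair E j l)"
      using counts_surj by blast
    have "l \<epsilon> n"
      using counts_bounded[OF n] by (auto simp: subset_iff)
    then have "k \<epsilon> n"
      using l(3) omega_mem_trans[OF n(1)] by blast
    moreover have "R n y"
      unfolding R_def using n(2) j(2) l(2) by (intro exI[of _ "upair E j l"] exI[of _ j]) auto
    ultimately show ?thesis
      using n(1) by blast
  qed
  ultimately show ?thesis
    unfolding covers_cofinally_def using pair by (intro exI[of _ e]) blast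
qed

section \<open>Extracting finite sets of sequences from one injective sequence\<close>

lemma finite_fun:
  assumes "is_finite E n" "is_fun E s n x"
  shows "is_finite E s"
proof (rule finite_covers[OF assms(1)])
  note sD = is_funD[OF assms(2)]
  show "covers n s"
  proof (rule coversI[where R = "\<lambda>u p. \<exists>w. p = \<langle>u, w\<rangle>"], intro definability)
    show "\<exists>u. u \<epsilon> n \<and> (\<exists>w. p = \<langle>u, w\<rangle>)" if "p \<epsilon> s" for p
      using sD(1)[OF that] by blast
  qed (use sD(4) in blast)
qed

text \<open>
  A Kuratowski pair of natural numbers is a finite set of finite sets of natural numbers.
\<close>

lemma seq_omega_subset: "seq E \<omega> \<sqsubseteq> fin E (fin E (fin E \<omega>))"
proof -
  have pair: "\<langle>u, w\<rangle> \<epsilon> fin E (fin E \<omega>)" if "u \<epsilon> \<omega>" "w \<epsilon> \<omega>" for u w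
    using that by (auto simp: opair_def subset_iff)
  have "s \<epsilon> fin E (fin E (fin E \<omega>))" if "n \<epsilon> \<omega>" "is_fun E s n \<omega>" for s n
  proof -
    have "p \<epsilon> fin E (fin E \<omega>)" if "p \<epsilon> s" for p
      using is_funD(1)[OF \<open>is_fun E s n \<omega>\<close> that] pair omega_trans(1)[OF \<open>n \<epsilon> \<omega>\<close>] by metis
    then show ?thesis
      using finite_fun[OF finite_omega that(2)] that(1) mem_fin[of s] subset_iff by simp
  qed
  then show ?thesis
    unfolding subset_iff mem_seq by blast
qed

lemma covers_cofinally_fin_seq: "covers_cofinally (fin E (seq E \<omega>))"
proof (rule covers_cofinallyI, rule omega_covers_fin)
  have "covers \<omega> (fin E (fin E (fin E \<omega>)))"
    by (intro omega_covers_fin covers_subset) (simp add: subset_iff)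
  then show "covers \<omega> (seq E \<omega>)"
    using covers_trans covers_subset[OF seq_omega_subset] by blast
qed

text \<open>
  An injection of a natural number into an infinite set is never onto, so it can be prolonged one step at
  a time; each step picks a single new element.
\<close>

lemma extend_injection:
  assumes x: "\<not> is_finite E x" and "n \<epsilon> \<omega>" "k \<epsilon> n" "is_inj E u k x"
  obtains u' where "u \<sqsubseteq> u'" "is_inj E u' n x"
proof -
  have "\<forall>k u. k \<epsilon> succ E n \<longrightarrow> is_inj E u k x \<longrightarrow> (\<exists>u'. u \<sqsubseteq> u' \<and> is_inj E u' n x)"
    using assms(2)
  proof (induction rule: omega_induct)
    case definable
    show ?case
      by (intro definability)
  next
    case zero
    then show ?case
      by (auto simp: subset_iff)
  next
    case (succ n)
    show ?case
    proof (intro allI impI)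
      fix k u assume k: "k \<epsilon> succ E (succ E n)" and u: "is_inj E u k x"
      show "\<exists>u'. u \<sqsubseteq> u' \<and> is_inj E u' (succ E n) x"
      proof (cases "k = succ E n")
        case True
        then show ?thesis
          using u by (auto simp: subset_iff)
      next
        case False
        then obtain f where f: "u \<sqsubseteq> f" "is_inj E f n x"
          using succ.IH k u mem_succ by metis
        note fD = is_funD[OF is_injD(1)[OF f(2)]] is_injD(2)[OF f(2)]
        have "\<exists>w. w \<epsilon> x \<and> (\<forall>i. \<not> \<langle>i, w\<rangle> \<epsilon> f)"
        proof (rule ccontr)
          assume "\<nexists>w. w \<epsilon> x \<and> (\<forall>i. \<not> \<langle>i, w\<rangle> \<epsilon> f)"
          then have "is_bij E f n x"
            using f(2) fD(2) unfolding is_bij_def by metis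
          then have "x \<approx> n"
            using equinumerous_sym unfolding equinumerous_def by blast
          then show False
            using x succ.hyps unfolding is_finite_def by blast
        qed
        then obtain w where w: "w \<epsilon> x" "\<And>i. \<not> \<langle>i, w\<rangle> \<epsilon> f"
          by blast
        define g where "g = adjoin \<langle>n, w\<rangle> f"
        have pair: "\<langle>i, a\<rangle> \<epsilon> g \<longleftrightarrow> \<langle>i, a\<rangle> \<epsilon> f \<or> i = n \<and> a = w" for i a
          by (simp add: g_def)
        have new: "\<not> \<langle>n, a\<rangle> \<epsilon> f" for a
          using fD(2) mem_irrefl by blast
        have "is_fun E g (succ E n) x"
        proof (rule is_funI)
          show "\<exists>i a. i \<epsilon> succ E n \<and> a \<epsilon> x \<and> p = \<langle>i, a\<rangle>" if "p \<epsilon> g" for p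
            using that fD(1)[of p] w(1) unfolding g_def mem_adjoin mem_succ by blast
          show "\<exists>a. \<langle>i, a\<rangle> \<epsilon> g" if "i \<epsilon> succ E n" for i
            using that fD(5) unfolding pair mem_succ by blast
          show "a = a'" if "\<langle>i, a\<rangle> \<epsilon> g" "\<langle>i, a'\<rangle> \<epsilon> g" for i a a'
            using that new fD(4) unfolding pair by blast
        qed
        then have "is_inj E g (succ E n) x"
          unfolding is_inj_def pair using fD(6) w(2) by blast
        moreover have "u \<sqsubseteq> g"
          using f(1) by (auto simp: subset_iff g_def)
        ultimately show ?thesis
          by blast
      qed
    qed
  qed
  then show ?thesis
    using assms(3,4) that mem_succ by blast
qed

definition compose :: "'v \<Rightarrow> 'v \<Rightarrow> 'v" where
  "compose s p = setof E (\<lambda>q. \<exists>i j w. q = \<langle>i, w\<rangle> \<and> \<langle>i, j\<rangle> \<epsilon> p \<and> \<langle>j, w\<rangle> \<epsilon> s)"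

lemma mem_compose: "q \<epsilon> compose s p \<longleftrightarrow> (\<exists>i j w. q = \<langle>i, w\<rangle> \<and> \<langle>i, j\<rangle> \<epsilon> p \<and> \<langle>j, w\<rangle> \<epsilon> s)"
proof -
  obtain c where c: "\<And>r. r \<epsilon> c \<longleftrightarrow> (\<exists>i w. i \<epsilon> big_union (big_union p) \<and> w \<epsilon> big_union (big_union s) \<and> r = \<langle>i, w\<rangle>)"
    by (rule productE[of "big_union (big_union p)" "big_union (big_union s)"]) blast
  show ?thesis
    unfolding compose_def
    by (rule mem_setof_bounded[where x = c], intro definability) (use c pair_mem_fields in blast)
qed

lemma pair_mem_compose [simp]: "\<langle>i, w\<rangle> \<epsilon> compose s p \<longleftrightarrow> (\<exists>j. \<langle>i, j\<rangle> \<epsilon> p \<and> \<langle>j, w\<rangle> \<epsilon> s)"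
  by (auto simp: mem_compose)

lemma definable_compose [definability]: "DT s \<Longrightarrow> DT t \<Longrightarrow> DT (\<lambda>v. compose (s v) (t v))"
  by (rule definable_term_subst2[where F = compose], rule definable_termI, rule mem_compose)
    (intro definability)

definition inverse_rel :: "'v \<Rightarrow> 'v" where
  "inverse_rel u = setof E (\<lambda>q. \<exists>i w. q = \<langle>w, i\<rangle> \<and> \<langle>i, w\<rangle> \<epsilon> u)"

lemma mem_inverse_rel: "q \<epsilon> inverse_rel u \<longleftrightarrow> (\<exists>i w. q = \<langle>w, i\<rangle> \<and> \<langle>i, w\<rangle> \<epsilon> u)"
proof -
  obtain c where c: "\<And>r. r \<epsilon> c \<longleftrightarrow> (\<exists>i w. i \<epsilon> big_union (big_union u) \<and> w \<epsilon> big_union (big_union u) \<and> r = \<langle>i, w\<rangle>)"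
    by (rule productE[of "big_union (big_union u)" "big_union (big_union u)"]) blast
  show ?thesis
    unfolding inverse_rel_def
    by (rule mem_setof_bounded[where x = c], intro definability) (use c pair_mem_fields in blast)
qed

lemma pair_mem_inverse_rel [simp]: "\<langle>w, i\<rangle> \<epsilon> inverse_rel u \<longleftrightarrow> \<langle>i, w\<rangle> \<epsilon> u"
  by (auto simp: mem_inverse_rel)

lemma finite_range:
  assumes "Q \<epsilon> fin E (seq E x)"
  obtains R where "is_finite E R" "R \<sqsubseteq> x" "\<And>t i w. t \<epsilon> Q \<Longrightarrow> \<langle>i, w\<rangle> \<epsilon> t \<Longrightarrow> w \<epsilon> R"
proof -
  have Q: "is_finite E Q" "\<And>t. t \<epsilon> Q \<Longrightarrow> \<exists>n. n \<epsilon> \<omega> \<and> is_fun E t n x"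
    using assms by (auto simp: subset_iff)
  have "is_finite E t" if "t \<epsilon> Q" for t
    using Q(2)[OF that] finite_fun finite_omega by blast
  then have fin: "is_finite E (big_union Q)"
    using finite_big_union Q(1) by blast
  have "D (\<lambda>v. \<exists>t i. t \<epsilon> Q \<and> \<langle>i, v 0\<rangle> \<epsilon> t)"
    by (intro definability)
  from this obtain R where R: "\<And>w. w \<epsilon> R \<longleftrightarrow> w \<epsilon> x \<and> (\<exists>t i. t \<epsilon> Q \<and> \<langle>i, w\<rangle> \<epsilon> t)"
    by (rule separationE[where x = x]) blast
  have "covers (big_union Q) R"
    by (rule coversI[where R = "\<lambda>p w. \<exists>i. p = \<langle>i, w\<rangle>"], intro definability) (use R in auto)
  then have "is_finite E R"
    using finite_covers fin by blast
  moreover have "R \<sqsubseteq> x"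
    using R by (simp add: subset_iff)
  moreover have "w \<epsilon> R" if "t \<epsilon> Q" "\<langle>i, w\<rangle> \<epsilon> t" for t i w
    using that R Q(2) is_funD(3) by blast
  ultimately show ?thesis
    using that by blast
qed

lemma finite_enumeration:
  assumes "is_finite E R" "R \<sqsubseteq> x"
  obtains k u where "k \<epsilon> \<omega>" "is_inj E u k x" "\<And>w. w \<epsilon> R \<Longrightarrow> \<exists>i. \<langle>i, w\<rangle> \<epsilon> u"
proof -
  obtain k where k: "k \<epsilon> \<omega>" "k \<approx> R"
    using assms(1) equinumerous_sym unfolding is_finite_def by blast
  obtain u where u: "is_inj E u k R" "\<And>w. w \<epsilon> R \<Longrightarrow> \<exists>i. \<langle>i, w\<rangle> \<epsilon> u"
    using equinumerousE[OF k(2)] by blast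
  have "is_inj E u k x"
    using u(1) assms(2) unfolding is_inj_def is_fun_def subset_iff by meson
  then show ?thesis
    using that k(1) u(2) by blast
qed

text \<open>
  Given a finite set \<open>Q\<close> of sequences, an injective sequence \<open>u\<close> enumerates a set \<open>R0\<close> that contains
  all their entries, and \<open>P\<close> consists of the patterns \<open>p = u\<inverse> \<circ> t\<close> for \<open>t \<in> Q\<close>. The sequence \<open>u\<close> is
  prolonged to a sequence \<open>s\<close> whose length is a code \<open>n\<close> of \<open>P\<close>; this is possible because codes of
  \<open>P\<close> occur beyond the length of \<open>u\<close>. Prolonging does not affect \<open>s \<circ> p = t\<close>.
\<close>

lemma seq_inj_covers_fin_seq:
  assumes x: "\<not> is_finite E x"
  shows "covers (seq_inj E x) (fin E (seq E x))"
proof -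
  obtain e where e: "\<And>n P P'. \<langle>n, P\<rangle> \<epsilon> e \<Longrightarrow> \<langle>n, P'\<rangle> \<epsilon> e \<Longrightarrow> P = P'"
    "\<And>P k. P \<epsilon> fin E (seq E \<omega>) \<Longrightarrow> k \<epsilon> \<omega> \<Longrightarrow> \<exists>n. n \<epsilon> \<omega> \<and> k \<epsilon> n \<and> \<langle>n, P\<rangle> \<epsilon> e"
    using covers_cofinally_fin_seq unfolding covers_cofinally_def by blast
  define R where "R s Q \<longleftrightarrow> (\<exists>n P. is_fun E s n x \<and> \<langle>n, P\<rangle> \<epsilon> e \<and>
    (\<forall>q. q \<epsilon> Q \<longleftrightarrow> (\<exists>p. p \<epsilon> P \<and> q = compose s p)))" for s Q
  have "D (\<lambda>v. R (v 0) (v 1))"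
    unfolding R_def by (intro definability)
  then show ?thesis
  proof (rule coversI)
    fix s Q Q' assume "R s Q" "R s Q'"
    then show "Q = Q'"
      unfolding R_def using e(1) is_fun_domain_unique by (metis set_eqI)
  next
    fix Q assume Q: "Q \<epsilon> fin E (seq E x)"
    then have finQ: "is_finite E Q" and seqQ: "\<And>t. t \<epsilon> Q \<Longrightarrow> \<exists>n. n \<epsilon> \<omega> \<and> is_fun E t n x"
      by (auto simp: subset_iff)
    obtain R0 where R0: "is_finite E R0" "R0 \<sqsubseteq> x"
      "\<And>t i w. t \<epsilon> Q \<Longrightarrow> \<langle>i, w\<rangle> \<epsilon> t \<Longrightarrow> w \<epsilon> R0"
      using finite_range[OF Q] by blast
    obtain k u where u: "k \<epsilon> \<omega>" "is_inj E u k x" "\<And>w. w \<epsilon> R0 \<Longrightarrow> \<exists>i. \<langle>i, w\<rangle> \<epsilon> u"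
      using finite_enumeration[OF R0(1,2)] by blast
    note uD = is_funD[OF is_injD(1)[OF u(2)]] is_injD(2)[OF u(2)]
    have pattern: "compose (inverse_rel u) t \<epsilon> seq E \<omega>" if t: "t \<epsilon> Q" for t
    proof -
      obtain n where n: "n \<epsilon> \<omega>" "is_fun E t n x"
        using seqQ[OF t] by blast
      note tD = is_funD[OF n(2)]
      have "is_fun E (compose (inverse_rel u) t) n \<omega>"
      proof (rule is_funI)
        show "\<exists>i j. i \<epsilon> n \<and> j \<epsilon> \<omega> \<and> p = \<langle>i, j\<rangle>" if p: "p \<epsilon> compose (inverse_rel u) t" for p
        proof -
          obtain i w j where "p = \<langle>i, j\<rangle>" "\<langle>i, w\<rangle> \<epsilon> t" "\<langle>j, w\<rangle> \<epsilon> u"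
            using p unfolding mem_compose pair_mem_inverse_rel by blast
          then show ?thesis
            using tD(2) uD(2) omega_trans(1)[OF u(1)] by blast
        qed
        show "\<exists>j. \<langle>i, j\<rangle> \<epsilon> compose (inverse_rel u) t" if "i \<epsilon> n" for i
          using tD(5)[OF that] R0(3)[OF t] u(3) by fastforce
        show "j = j'"
          if "\<langle>i, j\<rangle> \<epsilon> compose (inverse_rel u) t" "\<langle>i, j'\<rangle> \<epsilon> compose (inverse_rel u) t" for i j j'
          using that tD(4) uD(6) unfolding pair_mem_compose pair_mem_inverse_rel by metis
      qed
      then show ?thesis
        using n(1) by auto
    qed
    have "D (\<lambda>v. \<exists>t. t \<epsilon> Q \<and> v 0 = compose (inverse_rel u) t)"
      by (intro definability)
    from this obtain P where
      P': "\<And>p. p \<epsilon> P \<longleftrightarrow> p \<epsilon> seq E \<omega> \<and> (\<exists>t. t \<epsilon> Q \<and> p = compose (inverse_rel u) t)"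
      by (rule separationE[where x = "seq E \<omega>"]) blast
    have P: "p \<epsilon> P \<longleftrightarrow> (\<exists>t. t \<epsilon> Q \<and> p = compose (inverse_rel u) t)" for p
      using P' pattern by blast
    have "covers Q P"
      by (rule coversI[where R = "\<lambda>t p. p = compose (inverse_rel u) t"], intro definability) (use P in auto)
    then have "P \<epsilon> fin E (seq E \<omega>)"
      using finQ finite_covers P' by (simp add: subset_iff)
    then obtain n where n: "n \<epsilon> \<omega>" "k \<epsilon> n" "\<langle>n, P\<rangle> \<epsilon> e"
      using e(2) u(1) by blast
    obtain s where s: "u \<sqsubseteq> s" "is_inj E s n x"
      using extend_injection[OF x n(1,2) u(2)] by blast
    note sD = is_funD[OF is_injD(1)[OF s(2)]] is_injD(2)[OF s(2)]
    have us: "\<langle>j, w\<rangle> \<epsilon> u \<Longrightarrow> \<langle>j, w\<rangle> \<epsilon> s" for j w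
      using s(1) by (simp add: subset_iff)
    have recover: "compose s (compose (inverse_rel u) t) = t" if t: "t \<epsilon> Q" for t
    proof (rule set_eqI)
      fix q
      obtain n where "is_fun E t n x"
        using seqQ[OF t] by blast
      note tD = is_funD[OF this]
      show "q \<epsilon> compose s (compose (inverse_rel u) t) \<longleftrightarrow> q \<epsilon> t"
      proof
        assume "q \<epsilon> compose s (compose (inverse_rel u) t)"
        then obtain i j w w' where "q = \<langle>i, w\<rangle>" "\<langle>i, w'\<rangle> \<epsilon> t" "\<langle>j, w'\<rangle> \<epsilon> u" "\<langle>j, w\<rangle> \<epsilon> s"
          unfolding mem_compose[of q] by auto
        then show "q \<epsilon> t"
          using us sD(4) by metis
      next
        assume q: "q \<epsilon> t"
        then obtain i w where iw: "q = \<langle>i, w\<rangle>"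
          using tD(1) by blast
        then obtain j where "\<langle>j, w\<rangle> \<epsilon> u"
          using R0(3)[OF t] q u(3) by blast
        then show "q \<epsilon> compose s (compose (inverse_rel u) t)"
          using iw q us by auto
      qed
    qed
    have "q \<epsilon> Q \<longleftrightarrow> (\<exists>p. p \<epsilon> P \<and> q = compose s p)" for q
      using recover P by metis
    then have "R s Q"
      unfolding R_def using is_injD(1)[OF s(2)] n(3) by blast
    then show "\<exists>s. s \<epsilon> seq_inj E x \<and> R s Q"
      using s(2) n(1) by auto
  qed
qed

lemma seq_inj_subset_seq: "seq_inj E x \<sqsubseteq> seq E x"
  using is_injD(1) by (auto simp: subset_iff)

lemma seq_inj_covers_seq: "\<not> is_finite E x \<Longrightarrow> covers (seq_inj E x) (seq E x)"
  using covers_trans[OF seq_inj_covers_fin_seq covers_fin_self] .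

text \<open>
  This step carries the induction over the iterates of \<open>fin\<close>.
\<close>

lemma seq_inj_covers_fin:
  assumes "\<not> is_finite E x" "covers (seq_inj E x) Z"
  shows "covers (seq_inj E x) (fin E Z)"
proof -
  have "covers (seq E x) Z"
    using covers_trans[OF covers_subset[OF seq_inj_subset_seq] assms(2)] .
  then show ?thesis
    using covers_trans[OF seq_inj_covers_fin_seq[OF assms(1)] covers_fin] by blast
qed

lemma seq_inj_covers_self:
  assumes "\<not> is_finite E x"
  shows "covers (seq_inj E x) x"
proof -
  have "covers (seq E x) x"
  proof (rule coversI[where R = "\<lambda>s w. \<langle>\<emptyset>, w\<rangle> \<epsilon> s"], intro definability)
    show "w = w'" if "s \<epsilon> seq E x" "\<langle>\<emptyset>, w\<rangle> \<epsilon> s" "\<langle>\<emptyset>, w'\<rangle> \<epsilon> s" for s w w'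
      using that is_funD(4) by auto
    show "\<exists>s. s \<epsilon> seq E x \<and> \<langle>\<emptyset>, w\<rangle> \<epsilon> s" if "w \<epsilon> x" for w
    proof -
      have "is_fun E (upair E \<langle>\<emptyset>, w\<rangle> \<langle>\<emptyset>, w\<rangle>) (succ E \<emptyset>) x"
        by (rule is_funI) (use that in auto)
      then show ?thesis
        using succ_omega[OF zero_omega] by (metis mem_seq mem_upair)
    qed
  qed
  then show ?thesis
    using covers_trans seq_inj_covers_seq[OF assms] by blast
qed

section \<open>Injective sequences and chains of finite sets\<close>

text \<open>
  \<open>C\<close> is the chain of the ranges of the initial segments of \<open>s\<close>, up to and including \<open>s\<close> itself.
\<close>

definition segment_ranges :: "'v \<Rightarrow> 'v \<Rightarrow> 'v \<Rightarrow> bool" where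
  "segment_ranges s n C \<longleftrightarrow> (\<forall>A. A \<epsilon> C \<longleftrightarrow> (\<exists>k. k \<epsilon> succ E n \<and> A = rel_image s k))"

lemma omega_subset_linear:
  assumes "k \<epsilon> \<omega>" "j \<epsilon> \<omega>"
  shows "j \<sqsubseteq> k \<or> succ E k \<sqsubseteq> j"
proof -
  consider "j \<epsilon> k" | "j = k" | "k \<epsilon> j"
    using omega_linear[OF assms] by blast
  then show ?thesis
  proof cases
    case 3
    then show ?thesis
      using omega_mem_trans[OF assms(2)] by (auto simp: subset_iff)
  qed (use omega_trans(2)[OF assms(1)] in \<open>auto simp: subset_iff\<close>)
qed

text \<open>
  Suppose that \<open>s\<close> and \<open>t\<close> agree below \<open>k\<close>. The range of \<open>s\<close> on \<open>k + 1\<close> is also the range of \<open>t\<close> on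
  some \<open>j\<close>. As \<open>s k\<close> is a new value, \<open>j\<close> exceeds \<open>k\<close>, so \<open>t k\<close> belongs to the range of \<open>s\<close> on \<open>k + 1\<close>;
  being new for \<open>t\<close>, it is different from all earlier values and must be \<open>s k\<close>.
\<close>

lemma segment_ranges_agree:
  assumes s: "n \<epsilon> \<omega>" "is_inj E s n x" "segment_ranges s n C"
    and t: "m \<epsilon> \<omega>" "is_inj E t m x" "segment_ranges t m C"
    and "\<langle>i, w\<rangle> \<epsilon> s"
  shows "\<langle>i, w\<rangle> \<epsilon> t"
proof -
  note sD = is_funD[OF is_injD(1)[OF s(2)]] is_injD(2)[OF s(2)]
  note tD = is_funD[OF is_injD(1)[OF t(2)]] is_injD(2)[OF t(2)]
  have agree: "k \<sqsubseteq> n \<longrightarrow> (\<forall>i w. i \<epsilon> k \<longrightarrow> \<langle>i, w\<rangle> \<epsilon> s \<longrightarrow> \<langle>i, w\<rangle> \<epsilon> t)" if "k \<epsilon> \<omega>" for k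
    using that
  proof (induction rule: omega_induct)
    case definable
    show ?case
      by (intro definability)
  next
    case zero
    show ?case
      by simp
  next
    case (succ k)
    show ?case
    proof
      assume "succ E k \<sqsubseteq> n"
      then have k: "k \<epsilon> n" and IH: "\<And>i w. i \<epsilon> k \<Longrightarrow> \<langle>i, w\<rangle> \<epsilon> s \<Longrightarrow> \<langle>i, w\<rangle> \<epsilon> t"
        using succ.IH by (auto simp: subset_iff)
      obtain a where a: "\<langle>k, a\<rangle> \<epsilon> s"
        using sD(5)[OF k] by blast
      have IH': "\<langle>i, w\<rangle> \<epsilon> s" if "i \<epsilon> k" "\<langle>i, w\<rangle> \<epsilon> t" for i w
        using that IH sD(5) omega_mem_trans[OF s(1) k] tD(4) by metis
      have "rel_image s (succ E k) \<epsilon> C"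
        using s(3) succ_mem_succ[OF s(1) k] unfolding segment_ranges_def by blast
      then obtain j where j: "j \<epsilon> succ E m" "rel_image s (succ E k) = rel_image t j"
        using t(3) unfolding segment_ranges_def by blast
      have j_om: "j \<epsilon> \<omega>"
        using j(1) t(1) omega_trans(1) succ_omega by blast
      have range: "(\<exists>i. i \<epsilon> succ E k \<and> \<langle>i, w\<rangle> \<epsilon> s) \<longleftrightarrow> (\<exists>i. i \<epsilon> j \<and> \<langle>i, w\<rangle> \<epsilon> t)" for w
        using arg_cong[OF j(2), of "\<lambda>A. w \<epsilon> A"] unfolding mem_rel_image .
      have "\<not> j \<sqsubseteq> k"
      proof
        assume jk: "j \<sqsubseteq> k"
        obtain i where "i \<epsilon> j" "\<langle>i, a\<rangle> \<epsilon> t"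
          using range a mem_succ by blast
        then have "i \<epsilon> k" "\<langle>i, a\<rangle> \<epsilon> s"
          using IH' jk by (auto simp: subset_iff)
        then show False
          using sD(6) a mem_irrefl by blast
      qed
      then have kj: "k \<epsilon> j"
        using omega_subset_linear[OF succ.hyps j_om] by (auto simp: subset_iff)
      then have "k \<epsilon> m"
        using j(1) omega_mem_trans[OF t(1)] by auto
      then obtain b where b: "\<langle>k, b\<rangle> \<epsilon> t"
        using tD(5) by blast
      then obtain i where i: "i \<epsilon> succ E k" "\<langle>i, b\<rangle> \<epsilon> s"
        using range kj by blast
      have "i = k"
      proof (rule ccontr)
        assume "i \<noteq> k"
        then have "\<langle>i, b\<rangle> \<epsilon> t"
          using IH i by simp
        then show False
          using tD(6) b \<open>i \<noteq> k\<close> by blast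
      qed
      then have "\<langle>k, a\<rangle> \<epsilon> t"
        using i a b sD(4) by metis
      then show "\<forall>i w. i \<epsilon> succ E k \<longrightarrow> \<langle>i, w\<rangle> \<epsilon> s \<longrightarrow> \<langle>i, w\<rangle> \<epsilon> t"
        using IH sD(4) a unfolding mem_succ by metis
    qed
  qed
  show ?thesis
    using agree[OF s(1)] sD(2) assms(7) by (simp add: subset_iff)
qed

lemma fin_fin_covers_seq_inj: "covers (fin E (fin E x)) (seq_inj E x)"
proof -
  define R where "R C s \<longleftrightarrow> (\<exists>n. n \<epsilon> \<omega> \<and> is_inj E s n x \<and> segment_ranges s n C)" for C s
  have "D (\<lambda>v. R (v 0) (v 1))"
    unfolding R_def segment_ranges_def by (intro definability)
  then show ?thesis
  proof (rule coversI)
    fix C s t assume "R C s" "R C t"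
    then obtain n m where s: "n \<epsilon> \<omega>" "is_inj E s n x" "segment_ranges s n C"
      and t: "m \<epsilon> \<omega>" "is_inj E t m x" "segment_ranges t m C"
      unfolding R_def by blast
    show "s = t"
    proof (rule set_eqI)
      fix p
      show "p \<epsilon> s \<longleftrightarrow> p \<epsilon> t"
        using segment_ranges_agree[OF s t] segment_ranges_agree[OF t s]
          is_funD(1)[OF is_injD(1)[OF s(2)]] is_funD(1)[OF is_injD(1)[OF t(2)]] by metis
    qed
  next
    fix s assume "s \<epsilon> seq_inj E x"
    then obtain n where s: "n \<epsilon> \<omega>" "is_inj E s n x"
      by auto
    note sD = is_funD[OF is_injD(1)[OF s(2)]]
    have seg: "rel_image s k \<epsilon> fin E x" if "k \<epsilon> succ E n" for k
    proof -
      have "covers k (rel_image s k)"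
        by (rule coversI[where R = "\<lambda>i w. \<langle>i, w\<rangle> \<epsilon> s"], intro definability) (use sD(4) in auto)
      then have "is_finite E (rel_image s k)"
        using that finite_covers finite_omega omega_trans(1)[OF succ_omega[OF s(1)]] by blast
      then show ?thesis
        using sD(3) by (auto simp: subset_iff)
    qed
    have "D (\<lambda>v. \<exists>k. k \<epsilon> succ E n \<and> v 0 = rel_image s k)"
      by (intro definability)
    from this obtain C where C: "\<And>A. A \<epsilon> C \<longleftrightarrow> A \<epsilon> fin E x \<and> (\<exists>k. k \<epsilon> succ E n \<and> A = rel_image s k)"
      by (rule separationE[where x = "fin E x"]) blast
    have "covers (succ E n) C"
      by (rule coversI[where R = "\<lambda>k A. A = rel_image s k"], intro definability) (use C in auto)
    then have "C \<epsilon> fin E (fin E x)"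
      using finite_covers finite_omega succ_omega s(1) C mem_fin[of C] subset_iff by metis
    moreover have "segment_ranges s n C"
      unfolding segment_ranges_def using C seg by blast
    ultimately show "\<exists>C. C \<epsilon> fin E (fin E x) \<and> R C s"
      unfolding R_def using s by blast
  qed
qed

section \<open>Iterated finite powersets\<close>

lemma definable_fin_base: "DT (\<lambda>v. fin E (v 0))"
  by (intro definability)

lemmas definable_iterate_fin [definability] = definable_iterate[OF definable_fin_base]

lemma fin_iter_eq:
  assumes "m \<epsilon> \<omega>" "iterate (fin E) x m y"
  shows "fin_iter E m x = y"
proof -
  have "fin_iter E m x = (THE y. iterate (fin E) x m y)"
    unfolding fin_iter_def iterate_def ..
  also have "\<dots> = y"
    using assms(2) iterate_unique[OF definable_fin_base assms(1) _ assms(2)] by blast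
  finally show ?thesis .
qed

lemma seq_inj_covers_iterate:
  assumes "\<not> is_finite E x" "m \<epsilon> \<omega>"
  shows "\<exists>y. iterate (fin E) x m y \<and> covers (seq_inj E x) y"
  using assms(2)
proof (induction rule: omega_induct)
  case definable
  show ?case
    by (intro definability)
next
  case zero
  show ?case
    using iterate_zero seq_inj_covers_self[OF assms(1)] by blast
next
  case (succ n)
  then show ?case
    using iterate_succ seq_inj_covers_fin[OF assms(1)] by blast
qed

text \<open>
  Once \<open>fin\<^sup>n x\<close> covers the injective sequences, so does every later iterate, because \<open>fin z\<close>
  covers \<open>z\<close> by singletons.
\<close>

lemma iterate_covers_seq_inj:
  assumes "m \<epsilon> \<omega>" "m = succ E (succ E \<emptyset>) \<or> succ E (succ E \<emptyset>) \<epsilon> m"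
  shows "\<exists>y. iterate (fin E) x m y \<and> covers y (seq_inj E x)"
proof -
  have two: "iterate (fin E) x (succ E (succ E \<emptyset>)) (fin E (fin E x))"
    by (intro iterate_succ iterate_zero) simp_all
  have "m = succ E (succ E \<emptyset>) \<or> succ E (succ E \<emptyset>) \<epsilon> m \<longrightarrow>
      (\<exists>y. iterate (fin E) x m y \<and> covers y (seq_inj E x))"
    using assms(1)
  proof (induction rule: omega_induct)
    case definable
    show ?case
      by (intro definability)
  next
    case zero
    have "\<emptyset> \<noteq> succ E (succ E \<emptyset>)"
      using mem_succ mem_zero by metis
    then show ?case
      by simp
  next
    case (succ n)
    show ?case
    proof
      assume "succ E n = succ E (succ E \<emptyset>) \<or> succ E (succ E \<emptyset>) \<epsilon> succ E n"
      then consider "succ E n = succ E (succ E \<emptyset>)" | "n = succ E (succ E \<emptyset>) \<or> succ E (succ E \<emptyset>) \<epsilon> n"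
        by auto
      then show "\<exists>y. iterate (fin E) x (succ E n) y \<and> covers y (seq_inj E x)"
      proof cases
        case 1
        then show ?thesis
          using two fin_fin_covers_seq_inj by metis
      next
        case 2
        then show ?thesis
          using succ iterate_succ covers_trans[OF covers_fin_self] by blast
      qed
    qed
  qed
  then show ?thesis
    using assms(2) by blast
qed

lemma pow_seq_inj_seq: "\<not> is_finite E x \<Longrightarrow> pow E (seq_inj E x) \<approx> pow E (seq E x)"
  by (intro pow_equinumerous seq_inj_covers_seq covers_subset seq_inj_subset_seq)

lemma pow_fin_iter_seq_inj:
  assumes "\<not> is_finite E x" "m \<epsilon> \<omega>" "m = succ E (succ E \<emptyset>) \<or> succ E (succ E \<emptyset>) \<epsilon> m"
  shows "pow E (fin_iter E m x) \<approx> pow E (seq_inj E x)"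
  using seq_inj_covers_iterate[OF assms(1,2)] iterate_covers_seq_inj[OF assms(2,3), of x]
    fin_iter_eq[OF assms(2)] pow_equinumerous by metis

section \<open>Cardinals\<close>

text \<open>
  Power sets of equinumerous sets are equinumerous, so the sets \<open>y\<close> equinumerous to \<open>F z\<close> contribute
  nothing beyond \<open>F z\<close> itself.
\<close>

lemma card_two_exp_card_op:
  "card_two_exp E (card_op E F (cardinality E x)) = {w. \<exists>z. z \<approx> x \<and> w \<approx> pow E (F z)}"
proof -
  have pow: "pow E y \<approx> pow E z" if "y \<approx> z" for y z
    using that by (intro pow_equinumerous covers_equinumerous) (auto intro: equinumerous_sym)
  have "card_two_exp E (card_op E F (cardinality E x)) =
      {w. \<exists>z y. z \<approx> x \<and> y \<approx> F z \<and> w \<approx> pow E y}"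
    unfolding card_two_exp_def card_op_def cardinality_def by blast
  also have "\<dots> = {w. \<exists>z. z \<approx> x \<and> w \<approx> pow E (F z)}"
    using pow equinumerous_refl equinumerous_trans by blast
  finally show ?thesis .
qed

text \<open>
  \<open>F\<close> and \<open>G\<close> are compared at one and the same representative \<open>z\<close> of the cardinal, which is infinite
  like every other representative.
\<close>

lemma card_two_exp_eq:
  assumes "infinite_cardinal E \<aa>" "\<And>z. \<not> is_finite E z \<Longrightarrow> pow E (F z) \<approx> pow E (G z)"
  shows "card_two_exp E (card_op E F \<aa>) = card_two_exp E (card_op E G \<aa>)"
proof -
  obtain x where x: "\<aa> = cardinality E x" "\<not> is_finite E x"
    using assms(1) unfolding infinite_cardinal_def by blast
  have "\<not> is_finite E z" if "z \<approx> x" for z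
    using that x(2) equinumerous_sym equinumerous_trans unfolding is_finite_def by blast
  then have "w \<approx> pow E (F z) \<longleftrightarrow> w \<approx> pow E (G z)" if "z \<approx> x" for z w
    using assms(2) that equinumerous_sym equinumerous_trans by blast
  then show ?thesis
    unfolding x(1) card_two_exp_card_op by blast
qed

end

theorem corollary2p8:
  fixes E :: "'v \<Rightarrow> 'v \<Rightarrow> bool" and \<aa> :: "'v set"
  assumes "ZF_model E"
    and "infinite_cardinal E \<aa>"
  shows "card_two_exp E (card_seq_inj E \<aa>) = card_two_exp E (card_seq E \<aa>) \<and>
    (\<forall>m. E m (omega E) \<and> (m = succ E (succ E (zero E)) \<or> E (succ E (succ E (zero E))) m) \<longrightarrow>
      card_two_exp E (card_fin_iter E m \<aa>) = card_two_exp E (card_seq E \<aa>))"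
proof -
  interpret ZF_model E
    by (rule assms(1))
  have "card_two_exp E (card_op E (seq_inj E) \<aa>) = card_two_exp E (card_op E (seq E) \<aa>)"
    by (intro card_two_exp_eq assms(2) pow_seq_inj_seq)
  moreover have "card_two_exp E (card_op E (fin_iter E m) \<aa>) = card_two_exp E (card_op E (seq E) \<aa>)"
    if "E m (omega E)" "m = succ E (succ E (zero E)) \<or> E (succ E (succ E (zero E))) m" for m
    using assms(2)
  proof (rule card_two_exp_eq)
    show "pow E (fin_iter E m z) \<approx> pow E (seq E z)" if "\<not> is_finite E z" for z
      using equinumerous_trans pow_fin_iter_seq_inj[OF that] pow_seq_inj_seq[OF that] \<open>E m (omega E)\<close>
        \<open>m = succ E (succ E (zero E)) \<or> E (succ E (succ E (zero E))) m\<close> by blast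
  qed
  ultimately show ?thesis
    unfolding card_seq_inj_def card_seq_def card_fin_iter_def by blast
qed

end
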